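(* Let $K \subset \mathbb{R}^2$ be a planar convex body (a compact convex set with nonempty interior), and for each positive integer $n$ let $K_n$ be the convex hull of $n$ points chosen independently and uniformly at random in $K$. Then for all positive integers $n$, $$E[f_i(K_{n+1})] > E[f_i(K_n)], \qquad i = 0,1,$$ where $f_0$ and $f_1$ denote the number of vertices and the number of edges, respectively.
   Context: For a polytope $P$, $f_i(P)$ denotes the number of $i$-dimensional faces of $P$. *)

theory Defs
  imports "HOL-Probability.Probability"
begin

text \<open>Number of i-dimensional faces of a convex set P (faces in the sense of face_of;
  the empty face has affine dimension -1 and is never counted, P itself is counted
  when its affine dimension is i).\<close>
definition num_faces :: "nat \<Rightarrow> 'a::euclidean_space set \<Rightarrow> nat" where
  "num_faces i P = card {F. F face_of P \<and> aff_dim F = int i}"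

definition expected_faces :: "nat \<Rightarrow> (real^2) set \<Rightarrow> nat \<Rightarrow> real" where
  "expected_faces i K n =
     (\<integral>x. real (num_faces i (convex hull (x ` {..<n})))
        \<partial>(PiM {..<n} (\<lambda>_. uniform_measure lborel K)))"

end

theory Submission
  imports Defs
begin

text \<open>In general position the vertices and the edges of the hull of \<open>n\<close> points are both counted by
  the ordered pairs of points with all the other points strictly to their left, so both expectations
  equal \<open>n (n - 1) E[T ^ (n - 2)]\<close>, where \<open>T\<close> is the fraction of the area of \<open>K\<close> to the left of the
  line through two random points. Describing that line by its slope \<open>m\<close> and intercept \<open>h\<close> turns the
  expectation into an integral over \<open>m\<close> of \<open>\<integral>L ^ 3 (S ^ (n - 2) + (1 - S) ^ (n - 2)) dh\<close>, with \<open>L\<close> the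
  chord length and \<open>S\<close> the area fraction below the chord. Since \<open>dS\<close> is proportional to \<open>L dh\<close> and
  \<open>L\<close> is concave, \<open>L\<^sup>2\<close> is a concave function of \<open>S\<close>, and this makes the integral for each
  single slope strictly increasing in \<open>n\<close> after multiplication by \<open>n (n - 1)\<close>.\<close>

text \<open>The difference \<open>(n + 1) * moment (n - 1) - (n - 1) * moment (n - 2)\<close>
  integrates \<open>L ^ 3\<close> against the weight
  \<open>(1 - s) ^ (n - 2) * (2 - (n + 1) * s)\<close> plus its mirror image under exchange of
  \<open>s\<close> and \<open>1 - s\<close>. Concavity of \<open>L\<^sup>2\<close> enters only
  through one consequence: \<open>L\<^sup>2 / S\<close> does not increase. Strictness is the
  delicate point. Either weighted integral may vanish alone, namely when \<open>L\<^sup>2\<close> is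
  proportional to \<open>S\<close>, as for the sections of a triangle parallel to a side, counted
  from the opposite vertex. The mirrored integral vanishes only if \<open>L\<^sup>2\<close> is
  proportional to \<open>1 - S\<close>, and the two cannot happen together. Small samples need care:
  ordered pairs count vertices correctly from two points on, edges only from three, because both
  orders of two points are listed for their single edge. The Bochner integral of a function that is
  not integrable is 0 by convention, so the face counts must be proved measurable on all samples,
  including coincident and collinear points.\<close>

section \<open>Faces of planar convex hulls\<close>

text \<open>Twice the signed area of the triangle \<open>p q r\<close>: positive exactly when
  \<open>r\<close> lies strictly to the left of the line directed from \<open>p\<close> to
  \<open>q\<close>.\<close>

definition cross_diff :: "real^2 \<Rightarrow> real^2 \<Rightarrow> real^2 \<Rightarrow> real"
  where "cross_diff p q r = (q $ 1 - p $ 1) * (r $ 2 - p $ 2) - (q $ 2 - p $ 2) * (r $ 1 - p $ 1)"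

definition spans_edge :: "(real^2) set \<Rightarrow> real^2 \<Rightarrow> real^2 \<Rightarrow> bool"
  where "spans_edge S p q \<longleftrightarrow>
    ((\<forall>r\<in>S. 0 \<le> cross_diff p q r) \<or> (\<forall>r\<in>S. cross_diff p q r \<le> 0)) \<and>
    (\<forall>r\<in>S. cross_diff p q r = 0 \<longrightarrow> r \<in> closed_segment p q)"

lemma inner_real2: "x \<bullet> y = x $ 1 * y $ 1 + x $ 2 * y $ 2" for x y :: "real^2"
  by (simp add: inner_vec_def sum_2)

lemma cross_diff_swap: "cross_diff q p r = - cross_diff p q r"
  by (simp add: cross_diff_def algebra_simps)

lemma cross_diff_rotate: "cross_diff p r q = - cross_diff p q r"
  by (simp add: cross_diff_def algebra_simps)

lemma cross_diff_self [simp]: "cross_diff p q p = 0" "cross_diff p q q = 0" "cross_diff p p q = 0"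
  by (simp_all add: cross_diff_def algebra_simps)

lemma cross_diff_eq_inner:
  "cross_diff p q r = vector [p $ 2 - q $ 2, q $ 1 - p $ 1] \<bullet> r - vector [p $ 2 - q $ 2, q $ 1 - p $ 1] \<bullet> p"
  by (simp add: cross_diff_def inner_real2 vector_2 algebra_simps)

lemma cross_diff_eq_0_if_mem_segment:
  assumes "r \<in> closed_segment p q" shows "cross_diff p q r = 0"
proof -
  obtain t where r: "r = (1 - t) *\<^sub>R p + t *\<^sub>R q" using assms by (auto simp: in_segment)
  show ?thesis unfolding r by (simp add: cross_diff_def algebra_simps)
qed

text \<open>The line through \<open>p\<close> and \<open>q\<close> supports the hull and so cuts out
  a face. A face of the hull of \<open>S\<close> is the hull of a subset of \<open>S\<close>, and by
  \<open>spans_edge\<close> that subset lies on the segment.\<close>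

lemma spans_edge_imp_face:
  assumes fin: "finite S" and pq: "p \<in> S" "q \<in> S" and E: "spans_edge S p q"
  shows "closed_segment p q face_of convex hull S"
proof -
  define a where "a = (vector [p $ 2 - q $ 2, q $ 1 - p $ 1] :: real^2)"
  have D: "cross_diff p q r = a \<bullet> r - a \<bullet> p" for r
    by (simp add: cross_diff_eq_inner a_def)
  have face: "(convex hull S \<inter> {x. a \<bullet> x = a \<bullet> p}) face_of convex hull S"
    using E unfolding spans_edge_def
  proof (elim conjE disjE)
    assume "\<forall>r\<in>S. 0 \<le> cross_diff p q r"
    then have "S \<subseteq> {x. a \<bullet> x \<ge> a \<bullet> p}" by (auto simp: D)
    then have "convex hull S \<subseteq> {x. a \<bullet> x \<ge> a \<bullet> p}"
      by (rule hull_minimal) (rule convex_halfspace_ge)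
    then show ?thesis by (intro face_of_Int_supporting_hyperplane_ge) auto
  next
    assume "\<forall>r\<in>S. cross_diff p q r \<le> 0"
    then have "S \<subseteq> {x. a \<bullet> x \<le> a \<bullet> p}" by (auto simp: D)
    then have "convex hull S \<subseteq> {x. a \<bullet> x \<le> a \<bullet> p}"
      by (rule hull_minimal) (rule convex_halfspace_le)
    then show ?thesis by (intro face_of_Int_supporting_hyperplane_le) auto
  qed
  obtain T where T: "T \<subseteq> S" "convex hull S \<inter> {x. a \<bullet> x = a \<bullet> p} = convex hull T"
    using face_of_convex_hull_subset[OF finite_imp_compact[OF fin] face] by metis
  have "T \<subseteq> {x. a \<bullet> x = a \<bullet> p}" using T hull_subset[of T convex] by auto
  with T(1) E have "T \<subseteq> closed_segment p q" by (auto simp: spans_edge_def D)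
  then have "convex hull T \<subseteq> closed_segment p q" by (rule hull_minimal) simp
  moreover have "closed_segment p q \<subseteq> convex hull S"
    unfolding segment_convex_hull using pq by (intro hull_mono) auto
  moreover have "closed_segment p q \<subseteq> {x. a \<bullet> x = a \<bullet> p}"
    using cross_diff_eq_0_if_mem_segment by (fastforce simp: D)
  ultimately have "convex hull S \<inter> {x. a \<bullet> x = a \<bullet> p} = closed_segment p q"
    using T by auto
  with face show ?thesis by simp
qed

text \<open>Faces of a polytope are exposed, so some functional \<open>a\<close> is maximal exactly
  on the segment. If \<open>a\<close> is nonzero, it is orthogonal to \<open>q - p\<close>, hence a
  multiple of the quarter turn of \<open>q - p\<close>, and agrees with
  \<open>cross_diff p q\<close> up to a factor and a constant. For \<open>a = 0\<close> the hull is
  the segment itself.\<close>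

lemma face_imp_spans_edge:
  assumes fin: "finite S" and pq: "p \<noteq> q" and F: "closed_segment p q face_of convex hull S"
  shows "spans_edge S p q"
proof -
  have "closed_segment p q exposed_face_of convex hull S"
    using exposed_face_of_polyhedron[OF polyhedron_convex_hull[OF fin]] F by blast
  then obtain a b where ab: "convex hull S \<subseteq> {x. a \<bullet> x \<le> b}"
    "closed_segment p q = convex hull S \<inter> {x. a \<bullet> x = b}"
    unfolding exposed_face_of_def by metis
  have S: "S \<subseteq> convex hull S" by (rule hull_subset)
  show ?thesis
  proof (cases "a = 0")
    case True
    have "p \<in> closed_segment p q" by simp
    with True ab(2) have "b = 0" by (auto split: if_splits)
    with True ab(2) have "closed_segment p q = convex hull S" by auto
    with S cross_diff_eq_0_if_mem_segment show ?thesis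
      unfolding spans_edge_def by fastforce
  next
    case False
    have p: "a \<bullet> p = b" using ab(2) ends_in_segment(1)[of p q] by auto
    have q: "a \<bullet> q = b" using ab(2) ends_in_segment(2)[of q p] by auto
    \<comment> \<open>\<open>w\<close> is the squared length of \<open>q - p\<close> and
      \<open>t\<close> the inner product of \<open>a\<close> with the quarter turn of
      \<open>q - p\<close>; their quotient is the factor of proportionality, kept undivided.\<close>
    define w where "w = (q $ 1 - p $ 1)\<^sup>2 + (q $ 2 - p $ 2)\<^sup>2"
    have w: "w > 0" using pq by (auto simp: w_def vec_eq_iff forall_2 sum_power2_gt_zero_iff)
    define t where "t = a $ 2 * (q $ 1 - p $ 1) - a $ 1 * (q $ 2 - p $ 2)"
    have "a $ 1 * (q $ 1 - p $ 1) + a $ 2 * (q $ 2 - p $ 2) = 0"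
      using p q by (simp add: inner_real2 algebra_simps)
    then have a: "w * a $ 1 = - t * (q $ 2 - p $ 2)" "w * a $ 2 = t * (q $ 1 - p $ 1)"
      unfolding w_def t_def by algebra+
    then have t: "t \<noteq> 0" using False w by (auto simp: vec_eq_iff forall_2)
    have D: "w * (a \<bullet> r - b) = t * cross_diff p q r" for r
    proof -
      have "w * (a \<bullet> r - b) = (w * a $ 1) * (r $ 1 - p $ 1) + (w * a $ 2) * (r $ 2 - p $ 2)"
        using p by (simp add: inner_real2 algebra_simps flip: p)
      also have "\<dots> = t * cross_diff p q r"
        unfolding a cross_diff_def by (simp add: algebra_simps)
      finally show ?thesis .
    qed
    have le: "t * cross_diff p q r \<le> 0" if "r \<in> S" for r
    proof -
      have "a \<bullet> r - b \<le> 0" using that ab(1) S by auto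
      then show ?thesis using w unfolding D[symmetric] by (simp add: mult_nonneg_nonpos)
    qed
    have "r \<in> closed_segment p q" if "r \<in> S" "cross_diff p q r = 0" for r
      using D[of r] that w ab(2) S by auto
    moreover have "(\<forall>r\<in>S. 0 \<le> cross_diff p q r) \<or> (\<forall>r\<in>S. cross_diff p q r \<le> 0)"
    proof (cases "t > 0")
      case True
      then show ?thesis using le by (auto simp: mult_le_0_iff)
    next
      case False
      then have "t < 0" using t by simp
      then show ?thesis using le by (auto simp: mult_le_0_iff)
    qed
    ultimately show ?thesis unfolding spans_edge_def by blast
  qed
qed

lemma face_of_segment_vertices:
  fixes p q :: "'a::euclidean_space"
  assumes "closed_segment p q face_of convex hull S"
  shows "p \<in> S" "q \<in> S"
proof -
  have "p extreme_point_of closed_segment p q" "q extreme_point_of closed_segment p q"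
    by (simp_all add: extreme_point_of_segment)
  with assms have "p extreme_point_of convex hull S" "q extreme_point_of convex hull S"
    by (simp_all add: extreme_point_of_face)
  then show "p \<in> S" "q \<in> S" by (simp_all add: extreme_point_of_convex_hull)
qed

lemma num_faces_0_convex_hull:
  assumes "finite S"
  shows "num_faces 0 (convex hull S) = card {v \<in> S. v \<notin> convex hull (S - {v})}"
proof -
  have "v extreme_point_of convex hull S \<longleftrightarrow> v \<in> S \<and> v \<notin> convex hull (S - {v})" for v
  proof
    assume v: "v extreme_point_of convex hull S"
    then have "v \<in> S" by (rule extreme_point_of_convex_hull)
    moreover have "convex hull (S - {v}) \<subseteq> convex hull S - {v}"
      using v hull_subset[of S convex]
      by (intro hull_minimal) (auto simp: extreme_point_of_stillconvex)
    ultimately show "v \<in> S \<and> v \<notin> convex hull (S - {v})" by auto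
  next
    assume "v \<in> S \<and> v \<notin> convex hull (S - {v})"
    then show "v extreme_point_of convex hull S"
      using extreme_point_of_convex_hull_insert[of "S - {v}" v] assms by (simp add: insert_absorb)
  qed
  then have "{F. F face_of convex hull S \<and> aff_dim F = int 0} =
      (\<lambda>v. {v}) ` {v \<in> S. v \<notin> convex hull (S - {v})}"
    by (auto simp: aff_dim_eq_0 face_of_singleton)
  then show ?thesis unfolding num_faces_def by (simp add: card_image)
qed

text \<open>An edge is a segment between two points of \<open>S\<close> and arises from both orders
  of its endpoints, whence the factor 2. As the formula covers degenerate \<open>S\<close>, it also
  serves for measurability.\<close>

lemma num_faces_1_convex_hull:
  fixes S :: "(real^2) set"
  assumes fin: "finite S"
  shows "2 * num_faces 1 (convex hull S) =
    card {(p, q) \<in> S \<times> S. p \<noteq> q \<and> spans_edge S p q}"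
proof -
  define E where "E = {(p, q) \<in> S \<times> S. p \<noteq> q \<and> spans_edge S p q}"
  define seg where "seg = (\<lambda>(p::real^2, q). closed_segment p q)"
  have finE: "finite E" unfolding E_def by (rule finite_subset[of _ "S \<times> S"]) (use fin in auto)
  have "{F. F face_of convex hull S \<and> aff_dim F = int 1} = seg ` E"
  proof (intro set_eqI iffI)
    fix F assume "F \<in> {F. F face_of convex hull S \<and> aff_dim F = int 1}"
    then have F: "F face_of convex hull S" "aff_dim F = 1" by auto
    have "compact F"
      by (rule face_of_imp_compact[OF convex_convex_hull finite_imp_compact_convex_hull[OF fin] F(1)])
    moreover have "convex F" using F(1) by (rule face_of_imp_convex)
    moreover have "collinear F" using F(2) by (simp add: collinear_aff_dim)
    moreover have "F \<noteq> {}" using F(2) by auto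
    ultimately obtain p q where pq: "F = closed_segment p q"
      using compact_convex_collinear_segment by metis
    have "p \<noteq> q" using F(2) pq by auto
    moreover have "p \<in> S" "q \<in> S" using face_of_segment_vertices F(1) pq by auto
    moreover have "spans_edge S p q" using face_imp_spans_edge[OF fin \<open>p \<noteq> q\<close>] F(1) pq by auto
    ultimately show "F \<in> seg ` E" unfolding E_def seg_def pq by force
  next
    fix F assume "F \<in> seg ` E"
    then obtain p q where pq: "p \<in> S" "q \<in> S" "p \<noteq> q" "spans_edge S p q" "F = closed_segment p q"
      by (auto simp: E_def seg_def)
    have "aff_dim F = 1"
      unfolding pq(5) segment_convex_hull aff_dim_convex_hull using pq(3) by (simp add: aff_dim_2)
    then show "F \<in> {F. F face_of convex hull S \<and> aff_dim F = int 1}"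
      using spans_edge_imp_face[OF fin pq(1,2,4)] pq(5) by simp
  qed
  then have "num_faces 1 (convex hull S) = card (seg ` E)" by (simp add: num_faces_def)
  moreover have "card E = 2 * card (seg ` E)"
  proof -
    have "card {e \<in> E. seg e = F} = 2" if F: "F \<in> seg ` E" for F
    proof -
      obtain p q where pq: "(p, q) \<in> E" "F = closed_segment p q" using F by (auto simp: seg_def)
      have "(q, p) \<in> E"
        using pq(1) by (auto simp: E_def spans_edge_def cross_diff_swap[of q p] closed_segment_commute)
      then have "{e \<in> E. seg e = F} = {(p, q), (q, p)}"
        using pq by (auto simp: seg_def doubleton_eq_iff closed_segment_commute)
      moreover have "p \<noteq> q" using pq(1) by (simp add: E_def)
      ultimately show ?thesis by simp
    qed
    then show ?thesis
      using sum.image_gen[OF finE, of "\<lambda>_. 1::nat" seg] by simp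
  qed
  ultimately show ?thesis by (simp add: E_def)
qed

text \<open>Each index carries the reciprocal of the multiplicity of its value, so the indices that
  share a value contribute 1 together. Distinct points are thus counted by a formula in the
  coordinates even when sample points coincide.\<close>

lemma card_image_weighted:
  assumes "finite I"
  shows "real (card {v \<in> f ` I. Q v}) =
    (\<Sum>i\<in>I. if Q (f i) then 1 / real (card {j \<in> I. f j = f i}) else 0)"
proof -
  have "(\<Sum>i\<in>I. if Q (f i) then 1 / real (card {j \<in> I. f j = f i}) else 0) =
     (\<Sum>v\<in>f ` I. \<Sum>i | i \<in> I \<and> f i = v. if Q (f i) then 1 / real (card {j \<in> I. f j = f i}) else 0)"
    by (rule sum.image_gen[OF assms])
  also have "\<dots> = (\<Sum>v\<in>f ` I. if Q v then 1 else 0)"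
  proof (rule sum.cong)
    fix v assume v: "v \<in> f ` I"
    have "(\<Sum>i | i \<in> I \<and> f i = v. if Q (f i) then 1 / real (card {j \<in> I. f j = f i}) else 0) =
      (\<Sum>i | i \<in> I \<and> f i = v. if Q v then 1 / real (card {j \<in> I. f j = v}) else 0)"
      by (rule sum.cong) auto
    moreover have "card {j \<in> I. f j = v} \<noteq> 0" using v assms by auto
    ultimately show "(\<Sum>i | i \<in> I \<and> f i = v. if Q (f i) then 1 / real (card {j \<in> I. f j = f i}) else 0)
        = (if Q v then 1 else 0)" by simp
  qed simp
  also have "\<dots> = real (card {v \<in> f ` I. Q v})"
    using assms by (simp add: sum.If_cases Int_def)
  finally show ?thesis ..
qed

section \<open>Oriented boundary edges as pairs of indices\<close>

text \<open>An index pair \<open>(i, j)\<close> is listed if all other points lie strictly to the left of the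
  oriented line through \<open>x i\<close> and \<open>x j\<close>; in general position these are the counterclockwise
  oriented boundary edges of the convex hull.\<close>

definition ccw_edges :: "'i set \<Rightarrow> ('i \<Rightarrow> real^2) \<Rightarrow> ('i \<times> 'i) set"
  where "ccw_edges I x = {(i, j) \<in> I \<times> I. i \<noteq> j \<and> (\<forall>k\<in>I - {i, j}. 0 < cross_diff (x i) (x j) (x k))}"

definition general_position :: "'i set \<Rightarrow> ('i \<Rightarrow> real^2) \<Rightarrow> bool"
  where "general_position I x \<longleftrightarrow> inj_on x I \<and>
    (\<forall>i\<in>I. \<forall>j\<in>I - {i}. \<forall>k\<in>I - {i, j}. cross_diff (x i) (x j) (x k) \<noteq> 0)"

text \<open>Away from the two endpoints no \<open>cross_diff\<close> vanishes, so weak inequalities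
  become strict and the segment clause concerns only \<open>i\<close> and \<open>j\<close>.\<close>

lemma spans_edge_iff_ccw_edges:
  assumes gp: "general_position I x" and ij: "i \<in> I" "j \<in> I" "i \<noteq> j"
  shows "spans_edge (x ` I) (x i) (x j) \<longleftrightarrow> (i, j) \<in> ccw_edges I x \<or> (j, i) \<in> ccw_edges I x"
proof -
  have neq: "cross_diff (x i) (x j) (x k) \<noteq> 0" if "k \<in> I - {i, j}" for k
    using gp ij that by (auto simp: general_position_def)
  have swap: "cross_diff (x j) (x i) (x k) = - cross_diff (x i) (x j) (x k)" for k
    by (rule cross_diff_swap)
  have pos: "(\<forall>k\<in>I. 0 \<le> cross_diff (x i) (x j) (x k)) \<longleftrightarrow> (\<forall>k\<in>I - {i, j}. 0 < cross_diff (x i) (x j) (x k))"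
    using neq by (auto simp: less_le dest: not_sym)
  have neg: "(\<forall>k\<in>I. cross_diff (x i) (x j) (x k) \<le> 0) \<longleftrightarrow> (\<forall>k\<in>I - {i, j}. cross_diff (x i) (x j) (x k) < 0)"
    using neq by (auto simp: less_le dest: not_sym)
  have "\<forall>k\<in>I. cross_diff (x i) (x j) (x k) = 0 \<longrightarrow> x k \<in> closed_segment (x i) (x j)"
    using neq by fastforce
  then show ?thesis
    using ij pos neg unfolding spans_edge_def ccw_edges_def by (auto simp: swap insert_commute)
qed

text \<open>Sending an oriented edge to its starting index is a bijection onto the vertices. Two
  edges starting at \<open>i\<close> would each have the end of the other on its left, against
  antisymmetry; an outgoing edge is found by turning a ray around the vertex.\<close>

lemma card_ccw_edges_eq_vertices:
  assumes fin: "finite I" and card: "card I \<ge> 2" and gp: "general_position I x"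
  shows "num_faces 0 (convex hull (x ` I)) = card (ccw_edges I x)"
proof -
  have inj: "inj_on x I" using gp by (simp add: general_position_def)
  define V where "V = {i \<in> I. x i \<notin> convex hull (x ` I - {x i})}"
  have "{v \<in> x ` I. v \<notin> convex hull (x ` I - {v})} = x ` V" by (auto simp: V_def)
  then have "num_faces 0 (convex hull (x ` I)) = card V"
    using num_faces_0_convex_hull[of "x ` I"] fin inj
    by (simp add: card_image inj_on_subset[OF inj] V_def)
  also have "card V = card (ccw_edges I x)"
  proof (rule bij_betw_same_card[symmetric], rule bij_betwI')
    fix e e' assume "e \<in> ccw_edges I x" "e' \<in> ccw_edges I x"
    then obtain i j i' j' where e: "e = (i, j)" "e' = (i', j')" "(i, j) \<in> ccw_edges I x" "(i', j') \<in> ccw_edges I x"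
      by (metis prod.collapse)
    show "fst e = fst e' \<longleftrightarrow> e = e'"
    proof
      assume "fst e = fst e'"
      then have [simp]: "i' = i" using e by simp
      have "j = j'"
      proof (rule ccontr)
        assume "j \<noteq> j'"
        then have "cross_diff (x i) (x j) (x j') > 0" "cross_diff (x i) (x j') (x j) > 0"
          using e by (auto simp: ccw_edges_def)
        then show False using cross_diff_rotate[of "x i" "x j'" "x j"] by simp
      qed
      then show "e = e'" using e by simp
    qed simp
  next
    fix e assume "e \<in> ccw_edges I x"
    then obtain i j where e: "e = (i, j)" "(i, j) \<in> ccw_edges I x" by (metis prod.collapse)
    then have ij: "i \<in> I" "j \<in> I" "i \<noteq> j" by (auto simp: ccw_edges_def)
    have "closed_segment (x i) (x j) face_of convex hull (x ` I)"
      using spans_edge_imp_face[of "x ` I" "x i" "x j"] spans_edge_iff_ccw_edges[OF gp ij] e fin ij by simp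
    moreover have "x i extreme_point_of closed_segment (x i) (x j)"
      by (simp add: extreme_point_of_segment)
    ultimately have "x i extreme_point_of convex hull (x ` I)" by (simp add: extreme_point_of_face)
    moreover have "convex hull (x ` I - {x i}) \<subseteq> convex hull (x ` I) - {x i}"
      using calculation hull_subset[of "x ` I" convex]
      by (intro hull_minimal) (auto simp: extreme_point_of_stillconvex)
    ultimately show "fst e \<in> V" using e ij by (auto simp: V_def)
  next
    fix i assume "i \<in> V"
    then have i: "i \<in> I" "x i \<notin> convex hull (x ` I - {x i})" by (auto simp: V_def)
    have "closed (convex hull (x ` I - {x i}))"
      using fin by (intro compact_imp_closed finite_imp_compact_convex_hull) auto
    then obtain u b where ub: "u \<bullet> x i < b" "\<And>y. y \<in> convex hull (x ` I - {x i}) \<Longrightarrow> b < u \<bullet> y"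
      using separating_hyperplane_closed_point[OF convex_convex_hull _ i(2)] by metis
    have u: "0 < u \<bullet> (x k - x i)" if "k \<in> I - {i}" for k
    proof -
      have "x k \<in> x ` I - {x i}" using that inj i(1) by (auto simp: inj_on_def)
      then have "b < u \<bullet> x k" by (intro ub(2) hull_inc)
      with ub(1) show ?thesis by (simp add: inner_diff_right)
    qed
    \<comment> \<open>\<open>s k\<close> is the tangent of the angle from \<open>u\<close> to
      \<open>x k - x i\<close>, finite because all other points lie strictly on one side of the
      vertex in direction \<open>u\<close>. The least angle belongs to the counterclockwise
      successor of the vertex.\<close>
    define s where "s = (\<lambda>k. (u $ 1 * (x k - x i) $ 2 - u $ 2 * (x k - x i) $ 1) / (u \<bullet> (x k - x i)))"
    have "I - {i} \<noteq> {}"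
    proof
      assume "I - {i} = {}"
      then have "card I \<le> 1" using card_mono[of "{i}" I] by auto
      with card show False by simp
    qed
    then have "Min (s ` (I - {i})) \<in> s ` (I - {i})" using fin by (intro Min_in) auto
    then obtain j where j: "j \<in> I - {i}" "s j = Min (s ` (I - {i}))" by (metis imageE)
    have "0 < cross_diff (x i) (x j) (x k)" if k: "k \<in> I - {i, j}" for k
    proof -
      have "s j \<le> s k" unfolding j(2) using fin k by (intro Min_le) auto
      define aj ak where "aj = x j - x i" and "ak = x k - x i"
      have pos: "0 < u \<bullet> aj" "0 < u \<bullet> ak" using u j k by (auto simp: aj_def ak_def)
      have "(u $ 1 * aj $ 2 - u $ 2 * aj $ 1) * (u \<bullet> ak) \<le> (u $ 1 * ak $ 2 - u $ 2 * ak $ 1) * (u \<bullet> aj)"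
        using \<open>s j \<le> s k\<close> pos unfolding s_def aj_def[symmetric] ak_def[symmetric]
        by (simp add: divide_simps mult.commute)
      \<comment> \<open>The difference of the tangents, cleared of denominators, is
        \<open>cross_diff\<close> scaled by the squared length of \<open>u\<close>.\<close>
      moreover have "(u $ 1 * ak $ 2 - u $ 2 * ak $ 1) * (u \<bullet> aj) - (u $ 1 * aj $ 2 - u $ 2 * aj $ 1) * (u \<bullet> ak)
        = (u \<bullet> u) * cross_diff (x i) (x j) (x k)"
        unfolding cross_diff_def inner_real2 aj_def ak_def vector_minus_component by algebra
      ultimately have "0 \<le> (u \<bullet> u) * cross_diff (x i) (x j) (x k)" by linarith
      moreover have "u \<bullet> u > 0" using pos(1) by (auto simp: inner_gt_zero_iff)
      ultimately have "0 \<le> cross_diff (x i) (x j) (x k)" by (simp add: zero_le_mult_iff)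
      moreover have "cross_diff (x i) (x j) (x k) \<noteq> 0"
        using gp i(1) j(1) k by (auto simp: general_position_def)
      ultimately show ?thesis by simp
    qed
    then have "(i, j) \<in> ccw_edges I x" using i(1) j(1) by (auto simp: ccw_edges_def)
    then show "\<exists>e\<in>ccw_edges I x. i = fst e" by force
  qed
  finally show ?thesis .
qed

text \<open>Closing under \<open>prod.swap\<close> instead of doubling keeps the formula right for
  two points, where \<open>ccw_edges\<close> already contains both orders.\<close>

lemma num_faces_1_index_pairs:
  assumes fin: "finite I" and gp: "general_position I x"
  shows "2 * num_faces 1 (convex hull (x ` I)) = card (ccw_edges I x \<union> prod.swap ` ccw_edges I x)"
proof -
  have inj: "inj_on x I" using gp by (simp add: general_position_def)
  have "{(p, q) \<in> x ` I \<times> x ` I. p \<noteq> q \<and> spans_edge (x ` I) p q}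
      = map_prod x x ` (ccw_edges I x \<union> prod.swap ` ccw_edges I x)"
  proof (intro set_eqI iffI)
    fix z assume "z \<in> {(p, q) \<in> x ` I \<times> x ` I. p \<noteq> q \<and> spans_edge (x ` I) p q}"
    then obtain i j where ij: "i \<in> I" "j \<in> I" "i \<noteq> j" "spans_edge (x ` I) (x i) (x j)" "z = map_prod x x (i, j)"
      by auto
    then have "(i, j) \<in> ccw_edges I x \<union> prod.swap ` ccw_edges I x"
      using spans_edge_iff_ccw_edges[OF gp ij(1-3)] by force
    then show "z \<in> map_prod x x ` (ccw_edges I x \<union> prod.swap ` ccw_edges I x)"
      unfolding ij(5) by (rule imageI)
  next
    fix z assume "z \<in> map_prod x x ` (ccw_edges I x \<union> prod.swap ` ccw_edges I x)"
    then obtain i j where ij: "z = (x i, x j)" "(i, j) \<in> ccw_edges I x \<or> (j, i) \<in> ccw_edges I x" by auto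
    then have ij': "i \<in> I" "j \<in> I" "i \<noteq> j" by (auto simp: ccw_edges_def)
    then have "x i \<noteq> x j" using inj by (auto simp: inj_on_def)
    then show "z \<in> {(p, q) \<in> x ` I \<times> x ` I. p \<noteq> q \<and> spans_edge (x ` I) p q}"
      using spans_edge_iff_ccw_edges[OF gp ij'] ij ij' by auto
  qed
  moreover have "inj_on (map_prod x x) (ccw_edges I x \<union> prod.swap ` ccw_edges I x)"
    by (rule inj_on_subset[OF map_prod_inj_on[OF inj inj]]) (auto simp: ccw_edges_def)
  ultimately show ?thesis
    using num_faces_1_convex_hull[of "x ` I"] fin by (simp add: card_image)
qed

lemma finite_ccw_edges: "finite I \<Longrightarrow> finite (ccw_edges I x)"
  by (rule finite_subset[of _ "I \<times> I"]) (auto simp: ccw_edges_def)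

text \<open>A third point cannot lie strictly to the left of both orientations of a line, so from
  three points on each edge is listed in one order only.\<close>

lemma card_ccw_edges_eq_edges:
  assumes fin: "finite I" and card: "card I \<ge> 3" and gp: "general_position I x"
  shows "num_faces 1 (convex hull (x ` I)) = card (ccw_edges I x)"
proof -
  have "ccw_edges I x \<inter> prod.swap ` ccw_edges I x = {}"
  proof (rule ccontr)
    assume "\<not> ?thesis"
    then obtain i j where ij: "(i, j) \<in> ccw_edges I x" "(j, i) \<in> ccw_edges I x" by auto
    have "card I - card {i, j} \<le> card (I - {i, j})" by (intro diff_card_le_card_Diff) simp
    moreover have "card {i, j} \<le> 2" by (simp add: card_insert_if)
    ultimately have "card (I - {i, j}) > 0" using card by linarith
    then obtain k where "k \<in> I - {i, j}" by (metis card_gt_0_iff ex_in_conv)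
    then have "0 < cross_diff (x i) (x j) (x k)" "0 < cross_diff (x j) (x i) (x k)"
      using ij by (auto simp: ccw_edges_def)
    then show False using cross_diff_swap[of "x j" "x i" "x k"] by simp
  qed
  then have "card (ccw_edges I x \<union> prod.swap ` ccw_edges I x) = 2 * card (ccw_edges I x)"
    using finite_ccw_edges[OF fin] by (simp add: card_Un_disjoint card_image)
  then show ?thesis using num_faces_1_index_pairs[OF fin gp] by simp
qed

section \<open>Concave chord lengths\<close>

lemma concave_on_upper_chord:
  fixes f :: "real \<Rightarrow> real"
  assumes "concave_on {a..b} f" "a \<le> x" "x < y" "y \<le> z" "z \<le> b"
  shows "f x * (z - y) + f z * (y - x) \<le> f y * (z - x)"
proof -
  define t where "t = (y - x) / (z - x)"
  have zx: "z - x > 0" using assms by simp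
  have t: "0 \<le> t" "t \<le> 1" using assms zx by (auto simp: t_def field_simps)
  have y: "y = (1 - t) * x + t * z"
  proof -
    have "t * (z - x) = y - x" using zx by (simp add: t_def)
    then show ?thesis by (simp add: algebra_simps)
  qed
  have "f ((1 - t) *\<^sub>R x + t *\<^sub>R z) \<ge> (1 - t) * f x + t * f z"
    using assms t by (intro concave_onD[OF assms(1)]) auto
  then have "f y \<ge> (1 - t) * f x + t * f z" by (simp flip: y)
  then have "f y * (z - x) \<ge> ((1 - t) * f x + t * f z) * (z - x)"
    using zx by (intro mult_right_mono) auto
  also have "((1 - t) * f x + t * f z) * (z - x) = f x * (z - x) - t * (z - x) * f x + t * (z - x) * f z"
    by (simp add: algebra_simps)
  also have "t * (z - x) = y - x" using zx by (simp add: t_def)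
  finally show ?thesis by (simp add: algebra_simps)
qed

lemma integral_affine:
  fixes p k h u v :: real
  assumes "u \<le> v" "k \<noteq> 0"
  shows "((\<lambda>x. p + k * (x - h)) has_integral
    ((p + k * (v - h))\<^sup>2 - (p + k * (u - h))\<^sup>2) / (2 * k)) {u..v}"
proof -
  have "((\<lambda>x. p + k * (x - h)) has_integral
    ((p + k * (v - h))\<^sup>2 / (2 * k) - (p + k * (u - h))\<^sup>2 / (2 * k))) {u..v}"
    using assms
    by (intro fundamental_theorem_of_calculus)
       (auto intro!: derivative_eq_intros simp: field_simps simp flip: has_real_derivative_iff_has_vector_derivative)
  then show ?thesis by (simp add: diff_divide_distrib)
qed

text \<open>If \<open>L\<close> has not grown from \<open>h\<close> to \<open>h0\<close>, the
  factors compare directly. Otherwise the secant through \<open>h\<close> and \<open>h0\<close> has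
  slope \<open>k > 0\<close>, lies above \<open>L\<close> to the left of \<open>h\<close> and below
  it between \<open>h\<close> and \<open>h0\<close>. So the left area is at most that of the
  triangle under the secant and the middle area at least that of the trapezoid, and both of these
  are given by squares of \<open>L h\<close> and \<open>L h0\<close>.\<close>

lemma concave_square_over_integral:
  fixes L :: "real \<Rightarrow> real"
  assumes conc: "concave_on {a..b} L" and nonneg: "\<And>x. x \<in> {a..b} \<Longrightarrow> 0 \<le> L x"
    and int: "L integrable_on {a..b}" and h: "a \<le> h" "h \<le> h0" "h0 \<le> b"
  shows "(L h0)\<^sup>2 * integral {a..h} L \<le> (L h)\<^sup>2 * integral {a..h0} L"
proof -
  define V where "V = (\<lambda>t. integral {a..t} L)"
  define p q where "p = L h" and "q = L h0"
  have pq: "0 \<le> p" "0 \<le> q" using nonneg h by (auto simp: p_def q_def)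
  have intab: "L integrable_on {u..v}" if "a \<le> u" "v \<le> b" for u v
    by (rule integrable_on_subinterval[OF int]) (use that in auto)
  have V0: "0 \<le> V h"
    unfolding V_def using h by (intro integral_nonneg intab nonneg) auto
  have Vsplit: "V h0 = V h + integral {h..h0} L"
    unfolding V_def using h by (intro Henstock_Kurzweil_Integration.integral_combine[symmetric] intab) auto
  have Vmono: "V h \<le> V h0"
    unfolding Vsplit using h by (simp, intro integral_nonneg intab nonneg) auto
  have "q\<^sup>2 * V h \<le> p\<^sup>2 * V h0"
  proof (cases "q \<le> p")
    case True
    then show ?thesis using V0 Vmono pq by (intro mult_mono power_mono) auto
  next
    case False
    then have hh0: "h < h0" using h by (cases "h = h0") (auto simp: p_def q_def)
    define k where "k = (q - p) / (h0 - h)"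
    have k: "k > 0" using False hh0 by (simp add: k_def)
    have lower: "p + k * (x - h) \<le> L x" if "x \<in> {h..h0}" for x
    proof (cases "x = h")
      case False
      then have "p * (h0 - x) + q * (x - h) \<le> L x * (h0 - h)"
        unfolding p_def q_def using that h by (intro concave_on_upper_chord[OF conc]) auto
      then have "(p * (h0 - x) + q * (x - h)) / (h0 - h) \<le> L x"
        using hh0 by (simp add: field_simps)
      also have "(p * (h0 - x) + q * (x - h)) / (h0 - h) = p + k * (x - h)"
        using hh0 by (simp add: k_def divide_simps) (simp add: algebra_simps)
      finally show ?thesis .
    qed (simp add: p_def)
    have upper: "L x \<le> p + k * (x - h)" if "x \<in> {a..h}" for x
    proof (cases "x = h")
      case False
      then have "L x * (h0 - h) + q * (h - x) \<le> p * (h0 - x)"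
        unfolding p_def q_def using that h by (intro concave_on_upper_chord[OF conc]) auto
      then have "L x \<le> (p * (h0 - x) - q * (h - x)) / (h0 - h)"
        using hh0 by (simp add: field_simps)
      also have "(p * (h0 - x) - q * (h - x)) / (h0 - h) = p + k * (x - h)"
        using hh0 by (simp add: k_def divide_simps) (simp add: algebra_simps)
      finally show ?thesis .
    qed (simp add: p_def)
    have "V h \<le> ((p + k * (h - h))\<^sup>2 - (p + k * (a - h))\<^sup>2) / (2 * k)"
      unfolding V_def using h k
      by (intro has_integral_le[OF integrable_integral[OF intab] integral_affine] upper) auto
    \<comment> \<open>Dropping the subtracted square leaves the full triangle between the zero of
      the secant and \<open>h\<close>.\<close>
    also have "\<dots> \<le> p\<^sup>2 / (2 * k)" using k by (simp add: divide_right_mono)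
    finally have 1: "V h \<le> p\<^sup>2 / (2 * k)" .
    have "((p + k * (h0 - h))\<^sup>2 - (p + k * (h - h))\<^sup>2) / (2 * k) \<le> integral {h..h0} L"
      using h k by (intro has_integral_le[OF integral_affine integrable_integral[OF intab]] lower) auto
    moreover have "p + k * (h0 - h) = q" using hh0 by (simp add: k_def)
    ultimately have 2: "(q\<^sup>2 - p\<^sup>2) / (2 * k) \<le> integral {h..h0} L" by simp
    have qp: "0 \<le> q\<^sup>2 - p\<^sup>2" using False pq by (simp add: power_mono)
    have "(q\<^sup>2 - p\<^sup>2) * V h \<le> (q\<^sup>2 - p\<^sup>2) * (p\<^sup>2 / (2 * k))"
      by (intro mult_left_mono 1 qp)
    also have "\<dots> = p\<^sup>2 * ((q\<^sup>2 - p\<^sup>2) / (2 * k))" by simp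
    also have "\<dots> \<le> p\<^sup>2 * integral {h..h0} L" by (intro mult_left_mono 2) auto
    finally show ?thesis unfolding Vsplit by (simp add: algebra_simps)
  qed
  then show ?thesis by (simp add: V_def p_def q_def)
qed

section \<open>Moments of a concave profile\<close>

lemma reflect_has_integral_Icc:
  fixes f :: "real \<Rightarrow> real"
  shows "((\<lambda>x. f (a + b - x)) has_integral i) {a..b} \<longleftrightarrow> (f has_integral i) {a..b}"
proof -
  have D: "((\<lambda>x. f (a + b - x)) has_integral i) {a..b}" if "(f has_integral i) {a..b}" for f
  proof (cases "a \<le> b")
    case True
    have "((\<lambda>x. f ((- 1) *\<^sub>R x + (a + b))) has_integral (1 / (\<bar>- 1\<bar> ^ DIM(real))) *\<^sub>R i)
        ((\<lambda>x. (1 / (- 1)) *\<^sub>R x + - ((1 / (- 1)) *\<^sub>R (a + b))) ` cbox a b)"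
      using that by (intro has_integral_affinity) auto
    moreover have "(\<lambda>x. (1 / (- 1)) *\<^sub>R x + - ((1 / (- 1)) *\<^sub>R (a + b))) ` cbox a b = {a..b}"
    proof -
      have "(\<lambda>x. (1 / (- 1)) *\<^sub>R x + - ((1 / (- 1)) *\<^sub>R (a + b))) ` cbox a b = (\<lambda>x. a + b - x) ` {a..b}"
        by (auto simp: algebra_simps)
      then show ?thesis using True by simp
    qed
    ultimately show ?thesis by simp
  qed (use that in auto)
  show ?thesis using D[of f] D[of "\<lambda>x. f (a + b - x)"] by auto
qed

text \<open>\<open>L\<close> models the lengths of parallel chords and may vanish at the ends, as
  for a triangle. Concavity gives continuity only inside the interval; integrability is drawn from
  that together with the bound \<open>B\<close>.\<close>

locale concave_profile =
  fixes L :: "real \<Rightarrow> real" and a b B :: real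
  assumes ab: "a < b" and conc: "concave_on {a..b} L"
    and nonneg: "\<And>x. x \<in> {a..b} \<Longrightarrow> 0 \<le> L x"
    and pos: "\<And>x. x \<in> {a<..<b} \<Longrightarrow> 0 < L x"
    and bounded: "\<And>x. x \<in> {a..b} \<Longrightarrow> L x \<le> B"
begin

definition S :: "real \<Rightarrow> real"
  where "S h = integral {a..h} L / integral {a..b} L"

lemma cont_L: "continuous_on {a<..<b} L"
proof -
  have "convex_on {a<..<b} (\<lambda>x. - L x)"
    using conc unfolding concave_on_def by (rule convex_on_subset) auto
  then have "continuous_on {a<..<b} (\<lambda>x. - L x)" by (intro convex_on_continuous) auto
  from continuous_on_minus[OF this] show ?thesis by simp
qed

lemma integrable_continuous_bounded:
  fixes f :: "real \<Rightarrow> real"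
  assumes "continuous_on {a<..<b} f" "\<And>x. x \<in> {a<..<b} \<Longrightarrow> \<bar>f x\<bar> \<le> C"
  shows "f integrable_on {a..b}"
proof -
  have "f integrable_on {a<..<b}"
  proof (rule measurable_bounded_by_integrable_imp_integrable)
    show "f \<in> borel_measurable (lebesgue_on {a<..<b})"
      by (rule continuous_imp_measurable_on_sets_lebesgue[OF assms(1)]) simp
    show "(\<lambda>_. C) integrable_on {a<..<b}"
      unfolding integrable_on_Icc_iff_Ioo[symmetric] by (rule integrable_const_ivl)
  qed (use assms(2) in auto)
  then show ?thesis by (simp add: integrable_on_Icc_iff_Ioo)
qed

lemma int_L: "L integrable_on {a..b}"
  by (rule integrable_continuous_bounded[OF cont_L, of B]) (use nonneg bounded in auto)

lemma int_L': "a \<le> u \<Longrightarrow> v \<le> b \<Longrightarrow> L integrable_on {u..v}"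
  by (rule integrable_on_subinterval[OF int_L]) auto

lemma integral_less:
  assumes "a \<le> u" "u < v" "v \<le> b"
  shows "integral {a..u} L < integral {a..v} L"
proof -
  \<comment> \<open>Quarter points keep the middle piece inside the open interval, where
    \<open>L\<close> is continuous and positive.\<close>
  define u' v' where "u' = (3 * u + v) / 4" and "v' = (u + 3 * v) / 4"
  have uv: "a < u'" "u < u'" "u' < v'" "v' < v" "v' < b"
    using assms by (auto simp: u'_def v'_def)
  have "0 < integral {u'..v'} L"
  proof -
    have "0 \<le> integral {u'..v'} L"
      using uv by (intro integral_nonneg int_L' nonneg) auto
    moreover have "integral {u'..v'} L \<noteq> 0"
    proof
      assume "integral {u'..v'} L = 0"
      with uv have "(L has_integral 0) (cbox u' v')"
        using int_L'[of u' v'] by (simp add: has_integral_iff)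
      moreover have "continuous_on (cbox u' v') L"
        by (rule continuous_on_subset[OF cont_L]) (use uv in auto)
      ultimately have "L u' = 0"
        using uv by (intro has_integral_0_cbox_imp_0[of u' v' L]) (auto intro!: nonneg)
      with pos[of u'] uv show False by auto
    qed
    ultimately show ?thesis by simp
  qed
  also have "\<dots> \<le> integral {u..v} L"
    using uv assms by (intro integral_subset_le int_L') (auto intro!: nonneg)
  finally show ?thesis
    using Henstock_Kurzweil_Integration.integral_combine[of a u v L] int_L'[of a v] assms by auto
qed

lemma integral_pos: "0 < integral {a..b} L"
  using integral_less[of a b] ab by simp

lemma S_bounds: "a \<le> h \<Longrightarrow> h \<le> b \<Longrightarrow> 0 \<le> S h \<and> S h \<le> 1"
  using integral_pos integral_less[of a h] integral_less[of h b]
  by (cases "h = a"; cases "h = b") (auto simp: S_def)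

lemma S_a: "S a = 0" and S_b: "S b = 1"
  using integral_pos by (auto simp: S_def)

lemma S_less: "a \<le> u \<Longrightarrow> u < v \<Longrightarrow> v \<le> b \<Longrightarrow> S u < S v"
  using integral_less integral_pos by (simp add: S_def divide_strict_right_mono)

lemma cont_S: "continuous_on {a..b} S"
  unfolding S_def
  by (intro continuous_on_divide indefinite_integral_continuous_1 int_L continuous_on_const)
     (use integral_pos in auto)

lemma deriv_S:
  assumes x: "x \<in> {a<..<b}"
  shows "(S has_real_derivative L x / integral {a..b} L) (at x)"
proof -
  have "isCont L x" using x cont_L by (simp add: continuous_on_eq_continuous_at)
  then have "continuous (at x within {a..b}) L" by (rule continuous_at_imp_continuous_at_within)
  then have "((\<lambda>u. integral {a..u} L) has_vector_derivative L x) (at x within {a..b})"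
    using integral_has_vector_derivative_continuous_at[of L a b x "{}"] int_L x by simp
  moreover have "at x within {a..b} = at x"
    using x by (intro at_within_interior) simp
  ultimately show ?thesis
    unfolding S_def by (intro DERIV_cdivide) (simp add: has_real_derivative_iff_has_vector_derivative)
qed

text \<open>Change of variables \<open>s = S h\<close>, where \<open>ds\<close> is
  \<open>L h dh\<close> divided by the total area. The derivative of \<open>S\<close> is known only
  inside the interval, hence the interior form of the fundamental theorem.\<close>

lemma S_substitution:
  fixes F f :: "real \<Rightarrow> real"
  assumes "\<And>x. (F has_real_derivative f x) (at x)"
  shows "((\<lambda>h. L h * f (S h)) has_integral (F 1 - F 0) * integral {a..b} L) {a..b}"
proof -
  have "((\<lambda>h. L h / integral {a..b} L * f (S h)) has_integral (F (S b) - F (S a))) {a..b}"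
  proof (rule fundamental_theorem_of_calculus_interior)
    have "continuous_on UNIV F"
      using assms by (meson DERIV_isCont continuous_at_imp_continuous_on)
    then show "continuous_on {a..b} (\<lambda>h. F (S h))"
      by (rule continuous_on_compose2[OF _ cont_S]) auto
    show "((\<lambda>h. F (S h)) has_vector_derivative L x / integral {a..b} L * f (S x)) (at x)"
      if "x \<in> {a<..<b}" for x
      using DERIV_chain2[OF assms deriv_S[OF that]]
      by (simp add: has_real_derivative_iff_has_vector_derivative mult.commute)
  qed (use ab in auto)
  from has_integral_mult_left[OF this, of "integral {a..b} L"] show ?thesis
    using integral_pos by (simp add: S_a S_b mult.commute mult.left_commute)
qed

lemma integrable_weighted:
  fixes f :: "real \<Rightarrow> real"
  assumes "continuous_on {0..1} f"
  shows "(\<lambda>h. L h ^ k * f (S h)) integrable_on {a..b}"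
proof -
  have "bounded (f ` {0..1})"
    using assms by (intro compact_imp_bounded compact_continuous_image) auto
  then obtain C where "\<forall>y\<in>f ` {0..1}. norm y \<le> C" unfolding bounded_iff ..
  then have C: "\<bar>f x\<bar> \<le> C" if "x \<in> {0..1}" for x using that by simp
  show ?thesis
  proof (rule integrable_continuous_bounded[where C = "B ^ k * C"])
    have "continuous_on {a<..<b} S" by (rule continuous_on_subset[OF cont_S]) auto
    moreover have "S ` {a<..<b} \<subseteq> {0..1}" using S_bounds by auto
    ultimately have "continuous_on {a<..<b} (\<lambda>h. f (S h))"
      by (rule continuous_on_compose2[OF assms])
    then show "continuous_on {a<..<b} (\<lambda>h. L h ^ k * f (S h))"
      by (intro continuous_on_mult continuous_on_power cont_L)
    show "\<bar>L x ^ k * f (S x)\<bar> \<le> B ^ k * C" if "x \<in> {a<..<b}" for x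
    proof -
      have "\<bar>L x\<bar> ^ k \<le> B ^ k" using that nonneg[of x] bounded[of x] by (intro power_mono) auto
      moreover have "\<bar>f (S x)\<bar> \<le> C" using that S_bounds[of x] by (intro C) auto
      ultimately show ?thesis
        unfolding abs_mult power_abs using zero_le_power[OF abs_ge_zero, of "L x" k]
        by (intro mult_mono) linarith+
    qed
  qed
qed

lemma S_IVT:
  assumes "0 \<le> s" "s \<le> 1" obtains h where "a \<le> h" "h \<le> b" "S h = s"
proof -
  have "\<exists>h\<ge>a. h \<le> b \<and> S h = s"
    using IVT'[of S a s b] assms ab cont_S by (auto simp: S_a S_b)
  with that show ?thesis by auto
qed

text \<open>As a function of the area \<open>s\<close>, the square of the chord length \<open>L\<close> is concave. The weight
  \<open>(1 - s) ^ (n - 2) * (2 - (n + 1) * s)\<close> changes sign only at \<open>s = 2 / (n + 1)\<close> and is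
  orthogonal to \<open>s\<close>, so it suffices to compare \<open>L\<^sup>2\<close> with the multiple of \<open>s\<close> that
  agrees with it at the sign change.\<close>

lemma weighted_integral_nonneg:
  fixes n :: nat
  assumes n: "n \<ge> 2"
  defines "f \<equiv> (\<lambda>s::real. (1 - s) ^ (n - 2) * (2 - (n + 1) * s))"
  shows "integral {a..b} (\<lambda>h. L h ^ 3 * f (S h)) \<ge> 0"
    and "integral {a..b} (\<lambda>h. L h ^ 3 * f (S h)) = 0 \<Longrightarrow>
      \<exists>c>0. \<forall>x\<in>{a<..<b}. S x \<noteq> 2 / (n + 1) \<longrightarrow> (L x)\<^sup>2 = c * S x"
proof -
  define s0 :: real where "s0 = 2 / (n + 1)"
  have s0: "0 < s0" "s0 < 1" using n by (auto simp: s0_def)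
  obtain h0 where h0: "a \<le> h0" "h0 \<le> b" "S h0 = s0" using S_IVT[of s0] s0 by auto
  have h0': "a < h0" "h0 < b"
    using h0 s0 S_a S_b by (metis less_eq_real_def less_irrefl)+
  define c where "c = (L h0)\<^sup>2 / s0"
  have c: "c > 0" using pos[of h0] h0' s0 by (simp add: c_def)
  have f_eq: "f s = (1 - s) ^ (n - 2) * ((n + 1) * (s0 - s))" for s
    by (simp add: f_def s0_def field_simps)
  have ratio: "(L v)\<^sup>2 * S u \<le> (L u)\<^sup>2 * S v" if "a \<le> u" "u \<le> v" "v \<le> b" for u v
    using concave_square_over_integral[OF conc nonneg int_L that] integral_pos
    by (simp add: S_def divide_right_mono)
  have diff_sign: "((L x)\<^sup>2 - c * S x) * (s0 - S x) \<ge> 0" if "x \<in> {a..b}" for x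
  proof (cases "x \<le> h0")
    case True
    then have "S x \<le> s0" using S_less[of x h0] that h0 by (cases "x = h0") auto
    moreover have "c * S x \<le> (L x)\<^sup>2"
      using ratio[of x h0] that h0 True s0 by (simp add: c_def field_simps)
    ultimately show ?thesis by (intro mult_nonneg_nonneg) auto
  next
    case False
    then have "s0 \<le> S x" using S_less[of h0 x] that h0 by auto
    moreover have "(L x)\<^sup>2 \<le> c * S x"
      using ratio[of h0 x] that h0 False s0 by (simp add: c_def field_simps)
    ultimately show ?thesis by (intro mult_nonpos_nonpos) auto
  qed
  \<comment> \<open>The subtracted term will integrate to 0, so \<open>G\<close> has the integral in
    question, but unlike the original integrand it is nonnegative pointwise.\<close>
  define G where "G = (\<lambda>x. L x ^ 3 * f (S x) - c * (L x * (S x * f (S x))))"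
  have G_eq: "G x = L x * (1 - S x) ^ (n - 2) * (n + 1) * (((L x)\<^sup>2 - c * S x) * (s0 - S x))" for x
    by (simp add: G_def f_eq power2_eq_square power3_eq_cube algebra_simps)
  have G_nonneg: "G x \<ge> 0" if "x \<in> {a..b}" for x
    unfolding G_eq using that nonneg S_bounds[of x]
    by (intro mult_nonneg_nonneg diff_sign zero_le_power) auto
  \<comment> \<open>This primitive of \<open>s * f s\<close> vanishes at 0 and, since
    \<open>n - 1\<close> is positive, also at 1; that is the orthogonality of the weight to
    \<open>s\<close>.\<close>
  have "((\<lambda>s. s\<^sup>2 * (1 - s) ^ (n - 1)) has_real_derivative s * f s) (at s)" for s
  proof -
    obtain k where k: "n = Suc (Suc k)" using n by (metis add_2_eq_Suc le_Suc_ex)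
    have "((\<lambda>s. (1 - s) ^ Suc k) has_real_derivative - (real (Suc k) * (1 - s) ^ k)) (at s)"
      by (rule derivative_eq_intros refl)+ simp
    moreover have "((\<lambda>s. s\<^sup>2) has_real_derivative 2 * s) (at s)"
      by (rule derivative_eq_intros refl)+ simp
    ultimately have "((\<lambda>s. s\<^sup>2 * (1 - s) ^ Suc k) has_real_derivative
        2 * s * (1 - s) ^ Suc k + - (real (Suc k) * (1 - s) ^ k) * s\<^sup>2) (at s)"
      by (intro DERIV_mult)
    moreover have "2 * s * (1 - s) ^ Suc k + - (real (Suc k) * (1 - s) ^ k) * s\<^sup>2 = s * f s"
      unfolding f_def k by (simp add: power2_eq_square algebra_simps)
    ultimately show ?thesis by (simp add: k)
  qed
  from S_substitution[OF this] have "((\<lambda>h. L h * (S h * f (S h))) has_integral 0) {a..b}"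
    using n by (simp add: power_0_left)
  from has_integral_mult_right[OF this, of c]
  have zero: "((\<lambda>h. c * (L h * (S h * f (S h)))) has_integral 0) {a..b}" by simp
  have f_cont: "continuous_on {0..1} f" unfolding f_def by (intro continuous_intros)
  have "(\<lambda>h. L h ^ 3 * f (S h)) integrable_on {a..b}"
    by (rule integrable_weighted[OF f_cont])
  from has_integral_diff[OF integrable_integral[OF this] zero]
  have G_int: "(G has_integral integral {a..b} (\<lambda>h. L h ^ 3 * f (S h))) {a..b}"
    by (simp add: G_def)
  show "integral {a..b} (\<lambda>h. L h ^ 3 * f (S h)) \<ge> 0"
    using has_integral_nonneg[OF G_int] G_nonneg by auto
  assume "integral {a..b} (\<lambda>h. L h ^ 3 * f (S h)) = 0"
  with G_int have G0: "(G has_integral 0) {a..b}" by simp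
  \<comment> \<open>A nonnegative continuous function with integral 0 vanishes. Each factor of
    \<open>G x\<close> other than \<open>(L x)\<^sup>2 - c * S x\<close> is nonzero when
    \<open>x\<close> is interior and \<open>S x\<close> avoids the sign change.\<close>
  have "(L x)\<^sup>2 = c * S x" if x: "x \<in> {a<..<b}" "S x \<noteq> s0" for x
  proof -
    define u v where "u = (a + x) / 2" and "v = (x + b) / 2"
    have uv: "a < u" "u < x" "x < v" "v < b" using x by (auto simp: u_def v_def)
    have "G integrable_on {u..v}"
      by (rule integrable_on_subinterval[of _ "{a..b}"]) (use G0 uv in auto)
    moreover from this have "integral {u..v} G \<le> integral {a..b} G"
      using G0 uv G_nonneg by (intro integral_subset_le) auto
    moreover have "integral {a..b} G = 0" using G0 by (simp add: integral_unique)
    moreover have "integral {u..v} G \<ge> 0"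
      using G_nonneg uv calculation(1) by (intro integral_nonneg) auto
    ultimately have "(G has_integral 0) (cbox u v)" by (simp add: has_integral_iff)
    moreover have "continuous_on (cbox u v) G"
    proof -
      have "continuous_on (cbox u v) L" "continuous_on (cbox u v) S"
        using uv by (auto intro: continuous_on_subset[OF cont_L] continuous_on_subset[OF cont_S])
      then show ?thesis unfolding G_def f_def by (intro continuous_intros)
    qed
    ultimately have "G x = 0"
      using uv by (intro has_integral_0_cbox_imp_0[of u v G]) (auto intro!: G_nonneg)
    moreover have "L x > 0" "S x < 1" using pos[OF x(1)] S_less[of x b] S_b x by auto
    ultimately show ?thesis using x unfolding G_eq by auto
  qed
  then show "\<exists>c>0. \<forall>x\<in>{a<..<b}. S x \<noteq> 2 / (n + 1) \<longrightarrow> (L x)\<^sup>2 = c * S x"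
    using c unfolding s0_def by (intro exI[of _ c]) auto
qed

text \<open>Turning the body upside down exchanges \<open>S\<close> and \<open>1 - S\<close>, so
  that one weighted inequality covers both halves of the moment.\<close>

lemma reflect: "concave_profile (\<lambda>x. L (a + b - x)) a b B"
proof
  have "convex_on {a..b} (\<lambda>x. - L (a + b - x))"
  proof (rule convex_onI)
    fix t x y :: real
    assume t: "0 < t" "t < 1" and xy: "x \<in> {a..b}" "y \<in> {a..b}"
    have "L ((1 - t) *\<^sub>R (a + b - x) + t *\<^sub>R (a + b - y)) \<ge> (1 - t) * L (a + b - x) + t * L (a + b - y)"
      using t xy by (intro concave_onD[OF conc]) auto
    moreover have "(1 - t) *\<^sub>R (a + b - x) + t *\<^sub>R (a + b - y) = a + b - ((1 - t) *\<^sub>R x + t *\<^sub>R y)"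
      by (simp add: algebra_simps)
    ultimately show "- L (a + b - ((1 - t) *\<^sub>R x + t *\<^sub>R y)) \<le> (1 - t) * - L (a + b - x) + t * - L (a + b - y)"
      by (simp add: algebra_simps)
  qed auto
  then show "concave_on {a..b} (\<lambda>x. L (a + b - x))" by (simp add: concave_on_def)
qed (use ab nonneg pos bounded in auto)

definition moment :: "nat \<Rightarrow> real"
  where "moment k = integral {a..b} (\<lambda>h. L h ^ 3 * (S h ^ k + (1 - S h) ^ k))"

text \<open>The difference of the two sides is \<open>I + J\<close>, the weighted integrals of the
  profile and of its mirror image. If both vanished, \<open>L\<^sup>2\<close> would equal
  \<open>c * S\<close> and \<open>d * (1 - S)\<close> apart from exceptional values, leaving
  finitely many values for \<open>S\<close>, which however attains all of
  \<open>{0..1}\<close>.\<close>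

lemma moment_less:
  fixes n :: nat
  assumes n: "n \<ge> 2"
  shows "(n - 1) * moment (n - 2) < (n + 1) * moment (n - 1)"
proof -
  interpret R: concave_profile "\<lambda>x. L (a + b - x)" a b B by (rule reflect)
  \<comment> \<open>This is \<open>(n + 1) * (1 - s) ^ (n - 1) - (n - 1) * (1 - s) ^ (n - 2)\<close>
    with the common power taken out.\<close>
  define f where "f = (\<lambda>s::real. (1 - s) ^ (n - 2) * (2 - (n + 1) * s))"
  have f_cont: "continuous_on A f" for A unfolding f_def by (intro continuous_intros)
  have R_S: "R.S (a + b - x) = 1 - S x" if "x \<in> {a..b}" for x
  proof -
    have I: "((\<lambda>x. L (a + b - x)) has_integral integral {a..b} L) {a..b}"
      using reflect_has_integral_Icc[of L a b] int_L by (simp add: has_integral_iff)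
    have "((\<lambda>y. L (a + b - y)) has_integral integral {x..b} L) {a..a + b - x}"
    proof -
      have "((\<lambda>y. L (x + b - y)) has_integral integral {x..b} L) {x..b}"
        using reflect_has_integral_Icc[of L x b] int_L' that by (simp add: has_integral_iff)
      from has_integral_affinity[of _ _ x b 1 "x - a"] this
      have "((\<lambda>y. L (x + b - (y + (x - a)))) has_integral integral {x..b} L) ((\<lambda>y. y + (a - x)) ` {x..b})"
        by (fastforce simp: algebra_simps)
      moreover have "(\<lambda>y. y + (a - x)) ` {x..b} = {a..a + b - x}"
        using image_add_atLeastAtMost'[of "a - x" x b] by (simp add: algebra_simps)
      ultimately show ?thesis by (simp add: algebra_simps)
    qed
    then have "R.S (a + b - x) = integral {x..b} L / integral {a..b} L"
      using I unfolding R.S_def by (simp add: has_integral_iff)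
    also have "integral {x..b} L = integral {a..b} L - integral {a..x} L"
      using Henstock_Kurzweil_Integration.integral_combine[of a x b L] int_L that by simp
    finally show ?thesis using integral_pos by (simp add: S_def diff_divide_distrib)
  qed
  define I J where "I = integral {a..b} (\<lambda>h. L h ^ 3 * f (S h))"
    and "J = integral {a..b} (\<lambda>h. L h ^ 3 * f (1 - S h))"
  have J: "J = integral {a..b} (\<lambda>h. L (a + b - h) ^ 3 * f (R.S h))"
  proof -
    have "((\<lambda>h. L (a + b - h) ^ 3 * f (R.S h)) has_integral integral {a..b} (\<lambda>h. L (a + b - h) ^ 3 * f (R.S h))) {a..b}"
      by (rule integrable_integral[OF R.integrable_weighted[OF f_cont]])
    then have "((\<lambda>h. L (a + b - (a + b - h)) ^ 3 * f (R.S (a + b - h))) has_integral integral {a..b} (\<lambda>h. L (a + b - h) ^ 3 * f (R.S h))) {a..b}"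
      by (subst reflect_has_integral_Icc[of "\<lambda>h. L (a + b - h) ^ 3 * f (R.S h)"])
    then have "((\<lambda>h. L h ^ 3 * f (1 - S h)) has_integral integral {a..b} (\<lambda>h. L (a + b - h) ^ 3 * f (R.S h))) {a..b}"
      by (rule has_integral_eq[rotated]) (simp add: R_S)
    then show ?thesis unfolding J_def by (simp add: integral_unique)
  qed
  have I0: "I \<ge> 0" unfolding I_def f_def by (rule weighted_integral_nonneg(1)[OF n])
  have J0: "J \<ge> 0" unfolding J f_def by (rule R.weighted_integral_nonneg(1)[OF n])
  have "I + J > 0"
  proof (rule ccontr)
    assume "\<not> ?thesis"
    with I0 J0 have "I = 0" "J = 0" by auto
    obtain c where c: "c > 0" "\<And>x. x \<in> {a<..<b} \<Longrightarrow> S x \<noteq> 2 / (n + 1) \<Longrightarrow> (L x)\<^sup>2 = c * S x"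
      using weighted_integral_nonneg(2)[OF n] \<open>I = 0\<close> unfolding I_def f_def by auto
    obtain d where d: "d > 0" "\<And>x. x \<in> {a<..<b} \<Longrightarrow> R.S x \<noteq> 2 / (n + 1) \<Longrightarrow> (L (a + b - x))\<^sup>2 = d * R.S x"
      using R.weighted_integral_nonneg(2)[OF n] \<open>J = 0\<close> unfolding J f_def by auto
    \<comment> \<open>The exceptional area fractions: the two ends, the sign changes of the two
      weights, and the only solution of \<open>c * s = d * (1 - s)\<close>.\<close>
    define P where "P = {0, 1, 2 / (n + 1), 1 - 2 / (n + 1), d / (c + d)}"
    have "{0..1} \<subseteq> P"
    proof
      fix s :: real assume s: "s \<in> {0..1}"
      then obtain h where h: "a \<le> h" "h \<le> b" "S h = s" using S_IVT[of s] by auto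
      show "s \<in> P"
      proof (rule ccontr)
        assume "s \<notin> P"
        then have "h \<noteq> a" "h \<noteq> b" and s: "s \<noteq> 2 / (n + 1)" "1 - s \<noteq> 2 / (n + 1)" "s \<noteq> d / (c + d)"
          using h S_a S_b by (auto simp: P_def)
        with h have h': "h \<in> {a<..<b}" by auto
        have "(L h)\<^sup>2 = c * s" using c(2)[OF h'] h s by auto
        moreover have "(L h)\<^sup>2 = d * (1 - s)" using d(2)[of "a + b - h"] h h' s R_S[of h] by auto
        ultimately have "s = d / (c + d)" using c(1) d(1) by (simp add: field_simps)
        with s show False by simp
      qed
    qed
    moreover have "finite P" by (simp add: P_def)
    ultimately have "finite {0..1::real}" by (rule finite_subset)
    then show False by (simp add: infinite_Icc)
  qed
  also have "I + J = integral {a..b} (\<lambda>h. L h ^ 3 * (f (S h) + f (1 - S h)))"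
  proof -
    have "continuous_on {0..1} (\<lambda>s. f (1 - s))" unfolding f_def by (intro continuous_intros)
    from integrable_weighted[OF this] integrable_weighted[OF f_cont] show ?thesis
      unfolding I_def J_def
      by (subst Henstock_Kurzweil_Integration.integral_add[symmetric]) (auto simp: algebra_simps)
  qed
  also have "\<dots> = integral {a..b} (\<lambda>h. (n + 1) * (L h ^ 3 * (S h ^ (n - 1) + (1 - S h) ^ (n - 1)))
      - (n - 1) * (L h ^ 3 * (S h ^ (n - 2) + (1 - S h) ^ (n - 2))))"
  proof (intro integral_cong)
    fix h
    obtain k where k: "n = Suc (Suc k)" using n by (metis add_2_eq_Suc le_Suc_ex)
    show "L h ^ 3 * (f (S h) + f (1 - S h)) = (n + 1) * (L h ^ 3 * (S h ^ (n - 1) + (1 - S h) ^ (n - 1)))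
      - (n - 1) * (L h ^ 3 * (S h ^ (n - 2) + (1 - S h) ^ (n - 2)))"
      unfolding f_def k by (simp add: algebra_simps)
  qed
  also have "\<dots> = (n + 1) * moment (n - 1) - (n - 1) * moment (n - 2)"
  proof -
    have "(\<lambda>h. L h ^ 3 * (S h ^ k + (1 - S h) ^ k)) integrable_on {a..b}" for k
      by (rule integrable_weighted) (intro continuous_intros)
    from integrable_on_mult_right[OF this] show ?thesis unfolding moment_def
      by (subst Henstock_Kurzweil_Integration.integral_diff) auto
  qed
  finally show ?thesis by simp
qed

end

section \<open>Pairs of points and lines\<close>

definition vec2 :: "real \<Rightarrow> real \<Rightarrow> real^2"
  where "vec2 x y = x *\<^sub>R axis 1 1 + y *\<^sub>R axis 2 1"

lemma vec2_nth [simp]: "vec2 x y $ 1 = x" "vec2 x y $ 2 = y"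
  by (simp_all add: vec2_def axis_def)

lemma vec2_eta: "vec2 (p $ 1) (p $ 2) = p"
  by (simp add: vec_eq_iff forall_2)

lemma measurable_vec2 [measurable (raw)]:
  "f \<in> borel_measurable M \<Longrightarrow> g \<in> borel_measurable M \<Longrightarrow> (\<lambda>x. vec2 (f x) (g x)) \<in> borel_measurable M"
  unfolding vec2_def by (intro borel_measurable_add borel_measurable_scaleR borel_measurable_const)

lemma measurable_vec_nth2 [measurable]: "(\<lambda>p::real^2. p $ i) \<in> borel_measurable borel"
  by (intro borel_measurable_continuous_onI continuous_intros)

lemma measurable_cross_diff [measurable (raw)]:
  assumes [measurable]: "f \<in> borel_measurable M" "g \<in> borel_measurable M" "h \<in> borel_measurable M"
  shows "(\<lambda>x. cross_diff (f x) (g x) (h x)) \<in> borel_measurable M"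
  unfolding cross_diff_def by measurable

text \<open>\<open>lborel\<close> is determined by its values on open boxes, and a box pulls back to
  a product of intervals. This opens \<open>real^2\<close> to iterated integration in
  coordinates.\<close>

lemma lborel_real2: "lborel = distr (lborel \<Otimes>\<^sub>M lborel) borel (\<lambda>(x, y). vec2 x y)"
proof (rule lborel_eqI)
  fix l u :: "real^2" assume le: "\<And>b. b \<in> Basis \<Longrightarrow> l \<bullet> b \<le> u \<bullet> b"
  have B: "(Basis :: (real^2) set) = {axis 1 1, axis 2 1}"
    by (auto simp: Basis_vec_def UNIV_2)
  have "axis 1 1 \<noteq> (axis 2 1 :: real^2)" by (simp add: axis_eq_axis)
  then have P: "(\<Prod>b\<in>Basis. (u - l) \<bullet> b) = (u $ 1 - l $ 1) * (u $ 2 - l $ 2)"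
    by (simp add: B inner_axis)
  have le': "l $ 1 \<le> u $ 1" "l $ 2 \<le> u $ 2"
    using le[of "axis 1 1"] le[of "axis 2 1"] by (auto simp: B inner_axis)
  have "(\<lambda>(x, y). vec2 x y) -` box l u \<inter> space (lborel \<Otimes>\<^sub>M lborel)
      = {l $ 1<..<u $ 1} \<times> {l $ 2<..<u $ 2}"
    by (auto simp: box_def B inner_axis space_pair_measure)
  then have "emeasure (distr (lborel \<Otimes>\<^sub>M lborel) borel (\<lambda>(x, y). vec2 x y)) (box l u)
      = emeasure (lborel \<Otimes>\<^sub>M lborel) ({l $ 1<..<u $ 1} \<times> {l $ 2<..<u $ 2})"
    by (subst emeasure_distr) auto
  also have "\<dots> = emeasure lborel {l $ 1<..<u $ 1} * emeasure lborel {l $ 2<..<u $ 2}"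
    by (rule lborel.emeasure_pair_measure_Times) auto
  also have "\<dots> = ennreal (\<Prod>b\<in>Basis. (u - l) \<bullet> b)"
    using le' by (simp add: P ennreal_mult)
  finally show "emeasure (distr (lborel \<Otimes>\<^sub>M lborel) borel (\<lambda>(x, y). vec2 x y)) (box l u)
      = ennreal (\<Prod>b\<in>Basis. (u - l) \<bullet> b)" .
qed simp

lemma nn_integral_lborel_real2:
  fixes f :: "real^2 \<Rightarrow> ennreal"
  assumes [measurable]: "f \<in> borel_measurable borel"
  shows "(\<integral>\<^sup>+p. f p \<partial>lborel) = (\<integral>\<^sup>+x. \<integral>\<^sup>+y. f (vec2 x y) \<partial>lborel \<partial>lborel)"
proof -
  have "(\<integral>\<^sup>+p. f p \<partial>lborel) = (\<integral>\<^sup>+z. f (case z of (x, y) \<Rightarrow> vec2 x y) \<partial>(lborel \<Otimes>\<^sub>M lborel))"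
    by (subst lborel_real2, rule nn_integral_distr) auto
  also have "\<dots> = (\<integral>\<^sup>+x. \<integral>\<^sup>+y. f (vec2 x y) \<partial>lborel \<partial>lborel)"
    by (subst lborel.nn_integral_fst[symmetric]) auto
  finally show ?thesis .
qed

text \<open>For a fixed abscissa the shear is a translation, so slicing by parallel lines of slope
  \<open>m\<close> introduces no Jacobian.\<close>

lemma nn_integral_shear:
  fixes f :: "real^2 \<Rightarrow> ennreal"
  assumes [measurable]: "f \<in> borel_measurable borel"
  shows "(\<integral>\<^sup>+p. f p \<partial>lborel) = (\<integral>\<^sup>+h. \<integral>\<^sup>+x. f (vec2 x (m * x + h)) \<partial>lborel \<partial>lborel)"
proof -
  have "(\<integral>\<^sup>+p. f p \<partial>lborel) = (\<integral>\<^sup>+x. \<integral>\<^sup>+y. f (vec2 x y) \<partial>lborel \<partial>lborel)"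
    by (rule nn_integral_lborel_real2) measurable
  also have "\<dots> = (\<integral>\<^sup>+x. \<integral>\<^sup>+h. f (vec2 x (m * x + h)) \<partial>lborel \<partial>lborel)"
  proof (rule nn_integral_cong)
    fix x :: real
    show "(\<integral>\<^sup>+y. f (vec2 x y) \<partial>lborel) = (\<integral>\<^sup>+h. f (vec2 x (m * x + h)) \<partial>lborel)"
      using nn_integral_real_affine[of "\<lambda>y. f (vec2 x y)" 1 "m * x"] by simp
  qed
  also have "\<dots> = (\<integral>\<^sup>+h. \<integral>\<^sup>+x. f (vec2 x (m * x + h)) \<partial>lborel \<partial>lborel)"
    by (rule lborel_pair.Fubini'[symmetric]) measurable
  finally show ?thesis .
qed

text \<open>An affine Blaschke--Petkantschin formula: a pair of points is described by the line
  \<open>y = m x + h\<close> through it and the two abscissae.\<close>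

lemma nn_integral_pairs_by_lines:
  fixes f :: "(real^2) \<times> (real^2) \<Rightarrow> ennreal"
  assumes [measurable]: "f \<in> borel_measurable (borel \<Otimes>\<^sub>M borel)"
  shows "(\<integral>\<^sup>+p. \<integral>\<^sup>+q. f (p, q) \<partial>lborel \<partial>lborel) =
    (\<integral>\<^sup>+m. \<integral>\<^sup>+h. \<integral>\<^sup>+x. \<integral>\<^sup>+x'. ennreal \<bar>x' - x\<bar> * f (vec2 x (m * x + h), vec2 x' (m * x' + h))
      \<partial>lborel \<partial>lborel \<partial>lborel \<partial>lborel)"
proof -
  have "(\<integral>\<^sup>+p. \<integral>\<^sup>+q. f (p, q) \<partial>lborel \<partial>lborel) =
      (\<integral>\<^sup>+x. \<integral>\<^sup>+y. \<integral>\<^sup>+q. f (vec2 x y, q) \<partial>lborel \<partial>lborel \<partial>lborel)"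
    by (rule nn_integral_lborel_real2) measurable
  also have "\<dots> = (\<integral>\<^sup>+x. \<integral>\<^sup>+y. \<integral>\<^sup>+x'. \<integral>\<^sup>+y'. f (vec2 x y, vec2 x' y') \<partial>lborel \<partial>lborel \<partial>lborel \<partial>lborel)"
    by (intro nn_integral_cong nn_integral_lborel_real2) measurable
  \<comment> \<open>The second ordinate is traded for the slope by
    \<open>y' = y + (x' - x) * m\<close>, with Jacobian \<open>\<bar>x' - x\<bar>\<close>; pairs on
    a vertical line form a null set.\<close>
  also have "\<dots> = (\<integral>\<^sup>+x. \<integral>\<^sup>+y. \<integral>\<^sup>+x'. \<integral>\<^sup>+m. ennreal \<bar>x' - x\<bar> * f (vec2 x y, vec2 x' (y + (x' - x) * m))
      \<partial>lborel \<partial>lborel \<partial>lborel \<partial>lborel)"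
  proof (rule nn_integral_cong, rule nn_integral_cong, rule nn_integral_cong_AE)
    fix x y :: real
    show "AE x' in lborel. (\<integral>\<^sup>+y'. f (vec2 x y, vec2 x' y') \<partial>lborel) =
      (\<integral>\<^sup>+m. ennreal \<bar>x' - x\<bar> * f (vec2 x y, vec2 x' (y + (x' - x) * m)) \<partial>lborel)"
      using AE_lborel_singleton[of x]
    proof eventually_elim
      case (elim x')
      have "(\<integral>\<^sup>+y'. f (vec2 x y, vec2 x' y') \<partial>lborel) =
          ennreal \<bar>x' - x\<bar> * (\<integral>\<^sup>+m. f (vec2 x y, vec2 x' (y + (x' - x) * m)) \<partial>lborel)"
        using elim by (intro nn_integral_real_affine) auto
      then show ?case by (simp add: nn_integral_cmult)
    qed
  qed
  also have "\<dots> = (\<integral>\<^sup>+x. \<integral>\<^sup>+y. \<integral>\<^sup>+m. \<integral>\<^sup>+x'. ennreal \<bar>x' - x\<bar> * f (vec2 x y, vec2 x' (y + (x' - x) * m))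
      \<partial>lborel \<partial>lborel \<partial>lborel \<partial>lborel)"
    by (intro nn_integral_cong lborel_pair.Fubini'[symmetric]) measurable
  also have "\<dots> = (\<integral>\<^sup>+x. \<integral>\<^sup>+m. \<integral>\<^sup>+y. \<integral>\<^sup>+x'. ennreal \<bar>x' - x\<bar> * f (vec2 x y, vec2 x' (y + (x' - x) * m))
      \<partial>lborel \<partial>lborel \<partial>lborel \<partial>lborel)"
    by (intro nn_integral_cong lborel_pair.Fubini'[symmetric]) measurable
  also have "\<dots> = (\<integral>\<^sup>+m. \<integral>\<^sup>+x. \<integral>\<^sup>+y. \<integral>\<^sup>+x'. ennreal \<bar>x' - x\<bar> * f (vec2 x y, vec2 x' (y + (x' - x) * m))
      \<partial>lborel \<partial>lborel \<partial>lborel \<partial>lborel)"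
    by (intro lborel_pair.Fubini'[symmetric]) measurable
  \<comment> \<open>With slope and abscissa fixed, \<open>y = m * x + h\<close> is a translation,
    and the second ordinate becomes \<open>m * x' + h\<close>.\<close>
  also have "\<dots> = (\<integral>\<^sup>+m. \<integral>\<^sup>+x. \<integral>\<^sup>+h. \<integral>\<^sup>+x'. ennreal \<bar>x' - x\<bar> * f (vec2 x (m * x + h), vec2 x' (m * x' + h))
      \<partial>lborel \<partial>lborel \<partial>lborel \<partial>lborel)"
  proof (rule nn_integral_cong, rule nn_integral_cong)
    fix m x :: real
    have "(\<integral>\<^sup>+y. \<integral>\<^sup>+x'. ennreal \<bar>x' - x\<bar> * f (vec2 x y, vec2 x' (y + (x' - x) * m)) \<partial>lborel \<partial>lborel) =
      (\<integral>\<^sup>+h. \<integral>\<^sup>+x'. ennreal \<bar>x' - x\<bar> * f (vec2 x (m * x + h), vec2 x' ((m * x + h) + (x' - x) * m)) \<partial>lborel \<partial>lborel)"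
      using nn_integral_real_affine[of "\<lambda>y. \<integral>\<^sup>+x'. ennreal \<bar>x' - x\<bar> * f (vec2 x y, vec2 x' (y + (x' - x) * m)) \<partial>lborel" 1 "m * x"]
      by simp
    also have "\<dots> = (\<integral>\<^sup>+h. \<integral>\<^sup>+x'. ennreal \<bar>x' - x\<bar> * f (vec2 x (m * x + h), vec2 x' (m * x' + h)) \<partial>lborel \<partial>lborel)"
      by (simp add: algebra_simps)
    finally show "(\<integral>\<^sup>+y. \<integral>\<^sup>+x'. ennreal \<bar>x' - x\<bar> * f (vec2 x y, vec2 x' (y + (x' - x) * m)) \<partial>lborel \<partial>lborel) =
      (\<integral>\<^sup>+h. \<integral>\<^sup>+x'. ennreal \<bar>x' - x\<bar> * f (vec2 x (m * x + h), vec2 x' (m * x' + h)) \<partial>lborel \<partial>lborel)" .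
  qed
  also have "\<dots> = (\<integral>\<^sup>+m. \<integral>\<^sup>+h. \<integral>\<^sup>+x. \<integral>\<^sup>+x'. ennreal \<bar>x' - x\<bar> * f (vec2 x (m * x + h), vec2 x' (m * x' + h))
      \<partial>lborel \<partial>lborel \<partial>lborel \<partial>lborel)"
    by (intro nn_integral_cong lborel_pair.Fubini'[symmetric]) measurable
  finally show ?thesis .
qed

text \<open>Each order of the abscissae contributes \<open>(d - c) ^ 3 / 6\<close>: this is the
  source of the cube of the chord length. \<open>u\<close> and \<open>v\<close> will be powers of
  the areas on the two sides of the line.\<close>

lemma nn_integral_interval_pairs:
  fixes c d :: real and u v :: ennreal
  assumes cd: "c \<le> d"
  shows "(\<integral>\<^sup>+x. \<integral>\<^sup>+x'. ennreal \<bar>x' - x\<bar> * (indicator {c..d} x * indicator {c..d} x' *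
      (if x < x' then u else v)) \<partial>lborel \<partial>lborel) = ennreal ((d - c) ^ 3 / 6) * (u + v)"
proof -
  have inner: "(\<integral>\<^sup>+x'. ennreal \<bar>x' - x\<bar> * (indicator {c..d} x * indicator {c..d} x' *
      (if x < x' then u else v)) \<partial>lborel) =
      u * (ennreal ((d - x)\<^sup>2 / 2) * indicator {c..d} x) + v * (ennreal ((x - c)\<^sup>2 / 2) * indicator {c..d} x)"
    (is "?L = ?R") for x
  proof (cases "x \<in> {c..d}")
    case True
    have "?L = (\<integral>\<^sup>+x'. u * (ennreal (x' - x) * indicator {x..d} x') + v * (ennreal (x - x') * indicator {c..x} x') \<partial>lborel)"
      using True by (intro nn_integral_cong) (auto simp: indicator_def abs_if mult.commute)
    also have "\<dots> = u * (\<integral>\<^sup>+x'. ennreal (x' - x) * indicator {x..d} x' \<partial>lborel) + v * (\<integral>\<^sup>+x'. ennreal (x - x') * indicator {c..x} x' \<partial>lborel)"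
      by (subst nn_integral_add) (auto simp: nn_integral_cmult)
    also have "(\<integral>\<^sup>+x'. ennreal (x' - x) * indicator {x..d} x' \<partial>lborel) = ennreal ((d - x)\<^sup>2 / 2 - (x - x)\<^sup>2 / 2)"
      using True by (intro nn_integral_FTC_Icc) (auto intro!: derivative_eq_intros)
    also have "(\<integral>\<^sup>+x'. ennreal (x - x') * indicator {c..x} x' \<partial>lborel) = ennreal (- ((x - x)\<^sup>2 / 2) - - ((x - c)\<^sup>2 / 2))"
      using True by (intro nn_integral_FTC_Icc) (auto intro!: derivative_eq_intros simp: field_simps)
    finally show ?thesis using True by simp
  qed simp
  have "(\<integral>\<^sup>+x. u * (ennreal ((d - x)\<^sup>2 / 2) * indicator {c..d} x) + v * (ennreal ((x - c)\<^sup>2 / 2) * indicator {c..d} x) \<partial>lborel) =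
      u * (\<integral>\<^sup>+x. ennreal ((d - x)\<^sup>2 / 2) * indicator {c..d} x \<partial>lborel) +
      v * (\<integral>\<^sup>+x. ennreal ((x - c)\<^sup>2 / 2) * indicator {c..d} x \<partial>lborel)"
    by (subst nn_integral_add) (auto simp: nn_integral_cmult)
  also have "(\<integral>\<^sup>+x. ennreal ((d - x)\<^sup>2 / 2) * indicator {c..d} x \<partial>lborel) = ennreal (- ((d - d) ^ 3 / 6) - - ((d - c) ^ 3 / 6))"
    using cd by (intro nn_integral_FTC_Icc) (auto intro!: derivative_eq_intros)
  also have "(\<integral>\<^sup>+x. ennreal ((x - c)\<^sup>2 / 2) * indicator {c..d} x \<partial>lborel) = ennreal ((d - c) ^ 3 / 6 - (c - c) ^ 3 / 6)"
    using cd by (intro nn_integral_FTC_Icc) (auto intro!: derivative_eq_intros)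
  finally show ?thesis unfolding inner by (simp add: distrib_left distrib_right mult.commute)
qed

section \<open>Sections of a convex body\<close>

locale planar_convex_body =
  fixes K :: "(real^2) set"
  assumes compact_K: "compact K" and convex_K: "convex K" and interior_K: "interior K \<noteq> {}"
begin

lemma K_sets [measurable]: "K \<in> sets borel"
  using compact_K by (intro borel_compact)

lemma emeasure_K_finite: "emeasure lborel K < \<infinity>"
  using compact_K by (intro emeasure_bounded_finite compact_imp_bounded)

lemma emeasure_K_pos: "0 < emeasure lborel K"
proof -
  obtain c e where ce: "e > 0" "ball c e \<subseteq> K"
    using interior_K by (auto simp: mem_interior)
  have "emeasure lborel (ball c e) \<noteq> 0"
    using content_ball_pos[OF ce(1), of c] by (auto simp: measure_def)
  moreover have "emeasure lborel (ball c e) \<le> emeasure lborel K"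
    using ce by (intro emeasure_mono) auto
  ultimately show ?thesis by (metis le_zero_eq not_gr_zero)
qed

definition chord :: "real \<Rightarrow> real \<Rightarrow> real set"
  where "chord m h = {x. vec2 x (m * x + h) \<in> K}"

text \<open>Chords are measured by their abscissae, so this is the Euclidean length divided by
  \<open>sqrt (1 + m\<^sup>2)\<close>. With this scaling the integral over the intercept is exactly
  the area.\<close>

definition len :: "real \<Rightarrow> real \<Rightarrow> real"
  where "len m h = measure lborel (chord m h)"

text \<open>The planar Brunn-Minkowski argument: by convexity, combinations of points on two
  parallel chords land in the intermediate chord. Concavity of \<open>len\<close> rests on
  it.\<close>

lemma chord_affine:
  assumes "x \<in> chord m h" "x' \<in> chord m h'" "0 \<le> t" "t \<le> 1"
  shows "(1 - t) * x + t * x' \<in> chord m ((1 - t) * h + t * h')"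
proof -
  have "(1 - t) *\<^sub>R vec2 x (m * x + h) + t *\<^sub>R vec2 x' (m * x' + h') \<in> K"
    using assms convex_K by (intro convexD) (auto simp: chord_def)
  also have "(1 - t) *\<^sub>R vec2 x (m * x + h) + t *\<^sub>R vec2 x' (m * x' + h') =
      vec2 ((1 - t) * x + t * x') (m * ((1 - t) * x + t * x') + ((1 - t) * h + t * h'))"
    by (simp add: vec_eq_iff forall_2 algebra_simps)
  finally show ?thesis by (simp add: chord_def)
qed

lemma bounded_chords: obtains R where "R > 0" "\<And>m h. chord m h \<subseteq> {-R..R}"
proof -
  obtain R where R: "R > 0" "\<And>p. p \<in> K \<Longrightarrow> norm p \<le> R"
    using compact_imp_bounded[OF compact_K] by (auto simp: bounded_pos)
  have "\<bar>x\<bar> \<le> R" if "x \<in> chord m h" for x m h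
    using R(2) that component_le_norm_cart[of "vec2 x (m * x + h)" 1] by (force simp: chord_def)
  with R(1) that[of R] show ?thesis by fastforce
qed

lemma chord_interval:
  obtains "chord m h = {}" | c d where "c \<le> d" "chord m h = {c..d}"
proof -
  have "convex (chord m h)"
  proof (rule convexI)
    fix x y u v :: real assume *: "x \<in> chord m h" "y \<in> chord m h" "0 \<le> u" "0 \<le> v" "u + v = 1"
    then have "u = 1 - v" by simp
    moreover have "(1 - v) * x + v * y \<in> chord m ((1 - v) * h + v * h)"
      using * by (intro chord_affine) auto
    moreover have "(1 - v) * h + v * h = h" by (simp add: algebra_simps)
    ultimately show "u *\<^sub>R x + v *\<^sub>R y \<in> chord m h" by simp
  qed
  moreover have "closed (chord m h)"
  proof -
    have "closed ((\<lambda>x. vec2 x (m * x + h)) -` K)"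
      unfolding vec2_def by (intro continuous_closed_vimage compact_imp_closed compact_K continuous_intros)
    then show ?thesis by (simp add: chord_def vimage_def)
  qed
  moreover have "bounded (chord m h)"
    using bounded_chords by (metis bounded_closed_interval bounded_subset)
  ultimately have "connected (chord m h) \<and> compact (chord m h)"
    by (simp add: convex_connected compact_eq_bounded_closed)
  then obtain c d where "chord m h = {c..d}" unfolding connected_compact_interval_1 by blast
  then show ?thesis using that by (cases "c \<le> d") auto
qed

lemma chord_sets [measurable]: "chord m h \<in> sets borel"
  by (rule chord_interval[of m h]) auto

lemma len_nonneg: "0 \<le> len m h"
  by (simp add: len_def)

lemma emeasure_chord: "emeasure lborel (chord m h) = ennreal (len m h)"
  unfolding len_def by (rule chord_interval[of m h]) auto

lemma nn_integral_chord: "(\<integral>\<^sup>+x. indicator K (vec2 x (m * x + h)) \<partial>lborel) = ennreal (len m h)"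
proof -
  have "(\<integral>\<^sup>+x. indicator K (vec2 x (m * x + h)) \<partial>lborel) = (\<integral>\<^sup>+x. indicator (chord m h) x \<partial>lborel)"
    by (intro nn_integral_cong) (simp add: indicator_def chord_def)
  also have "\<dots> = ennreal (len m h)" by (simp add: emeasure_chord)
  finally show ?thesis .
qed

lemma measurable_len [measurable]: "len m \<in> borel_measurable borel"
proof -
  have "len m = (\<lambda>h. enn2real (\<integral>\<^sup>+x. indicator K (vec2 x (m * x + h)) \<partial>lborel))"
    by (simp add: nn_integral_chord len_nonneg fun_eq_iff)
  also have "\<dots> \<in> borel_measurable borel" by measurable
  finally show ?thesis .
qed

text \<open>Cavalieri's principle after a shear. \<open>r $ 2 - m * r $ 1\<close> is the intercept
  of the line of slope \<open>m\<close> through \<open>r\<close>, so \<open>P\<close> can select all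
  of \<open>K\<close> or its part above or below a line.\<close>

lemma emeasure_K_slice:
  assumes [measurable]: "Measurable.pred borel P"
  shows "emeasure lborel {r \<in> K. P (r $ 2 - m * r $ 1)} =
    (\<integral>\<^sup>+h. indicator {h. P h} h * ennreal (len m h) \<partial>lborel)"
proof -
  have "emeasure lborel {r \<in> K. P (r $ 2 - m * r $ 1)} =
      (\<integral>\<^sup>+r. indicator {r \<in> K. P (r $ 2 - m * r $ 1)} r \<partial>lborel)"
    by (rule nn_integral_indicator[symmetric]) measurable
  also have "\<dots> = (\<integral>\<^sup>+h. \<integral>\<^sup>+x. indicator {r \<in> K. P (r $ 2 - m * r $ 1)} (vec2 x (m * x + h)) \<partial>lborel \<partial>lborel)"
    by (rule nn_integral_shear) measurable
  also have "\<dots> = (\<integral>\<^sup>+h. \<integral>\<^sup>+x. indicator {h. P h} h * indicator K (vec2 x (m * x + h)) \<partial>lborel \<partial>lborel)"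
    by (intro nn_integral_cong) (auto simp: indicator_def)
  also have "\<dots> = (\<integral>\<^sup>+h. indicator {h. P h} h * ennreal (len m h) \<partial>lborel)"
    by (simp add: nn_integral_cmult nn_integral_chord)
  finally show ?thesis .
qed

lemma nn_integral_len: "(\<integral>\<^sup>+h. ennreal (len m h) \<partial>lborel) = emeasure lborel K"
  using emeasure_K_slice[of "\<lambda>_. True" m] by simp

text \<open>The intercepts of the lines that meet \<open>K\<close> form a compact interval. One
  chord of positive length exists because \<open>K\<close> has positive area, and concavity spreads
  its positivity to the whole open interval.\<close>

lemma concave_profile_len:
  obtains a b B where "concave_profile (len m) a b B" "\<And>h. h \<notin> {a..b} \<Longrightarrow> len m h = 0"
proof -
  define H where "H = (\<lambda>p. p $ 2 - m * p $ 1) ` K"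
  have H_iff: "h \<in> H \<longleftrightarrow> chord m h \<noteq> {}" for h
  proof
    assume "h \<in> H"
    then obtain p where p: "p \<in> K" "h = p $ 2 - m * p $ 1" by (auto simp: H_def)
    then have "p $ 1 \<in> chord m h" by (simp add: chord_def vec2_eta)
    then show "chord m h \<noteq> {}" by auto
  next
    assume "chord m h \<noteq> {}"
    then obtain x where "vec2 x (m * x + h) \<in> K" by (auto simp: chord_def)
    then show "h \<in> H" unfolding H_def by (force intro: image_eqI[of _ _ "vec2 x (m * x + h)"])
  qed
  have "connected H" "compact H"
    unfolding H_def
    by (intro connected_continuous_image compact_continuous_image compact_K convex_connected convex_K continuous_intros)+
  then obtain a b where ab: "H = {a..b}" using connected_compact_interval_1 by blast
  have out: "len m h = 0" if "h \<notin> {a..b}" for h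
  proof -
    have "chord m h = {}" using that H_iff[of h] ab by auto
    then show ?thesis by (simp add: len_def)
  qed
  \<comment> \<open>If every chord other than the two extreme ones had length 0, Cavalieri's
    principle would give \<open>K\<close> area 0.\<close>
  obtain h1 where h1: "len m h1 > 0" "h1 \<noteq> a" "h1 \<noteq> b"
  proof (rule ccontr)
    assume "\<not> thesis"
    then have zero: "len m h = 0" if "h \<noteq> a" "h \<noteq> b" for h
      using that len_nonneg[of m h] \<open>\<And>h1. 0 < len m h1 \<Longrightarrow> h1 \<noteq> a \<Longrightarrow> h1 \<noteq> b \<Longrightarrow> thesis\<close> by force
    have "AE h in lborel. ennreal (len m h) = 0"
      using AE_lborel_singleton[of a] AE_lborel_singleton[of b] by eventually_elim (simp add: zero)
    then have "(\<integral>\<^sup>+h. ennreal (len m h) \<partial>lborel) = 0"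
      by (subst nn_integral_0_iff_AE) auto
    with nn_integral_len emeasure_K_pos show False by simp
  qed
  have h1ab: "a < h1" "h1 < b" using h1 out[of h1] by force+
  have cv: "len m ((1 - t) * u + t * v) \<ge> (1 - t) * len m u + t * len m v"
    if t: "0 \<le> t" "t \<le> 1" and uv: "u \<in> {a..b}" "v \<in> {a..b}" for t u v
  proof -
    obtain c d where cd: "c \<le> d" "chord m u = {c..d}"
      using chord_interval[of m u] uv H_iff ab by auto
    obtain c' d' where cd': "c' \<le> d'" "chord m v = {c'..d'}"
      using chord_interval[of m v] uv H_iff ab by auto
    have 1: "(1 - t) * c + t * c' \<in> chord m ((1 - t) * u + t * v)"
      using cd cd' t by (intro chord_affine) auto
    have 2: "(1 - t) * d + t * d' \<in> chord m ((1 - t) * u + t * v)"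
      using cd cd' t by (intro chord_affine) auto
    obtain e f where ef: "e \<le> f" "chord m ((1 - t) * u + t * v) = {e..f}"
      using chord_interval[of m "(1 - t) * u + t * v"] 1 by auto
    have "(1 - t) * (d - c) + t * (d' - c') \<le> f - e"
      using 1 2 unfolding ef by (simp add: algebra_simps)
    then show ?thesis using ef cd cd' by (simp add: len_def)
  qed
  have conc: "concave_on {a..b} (len m)"
    unfolding concave_on_def
  proof (rule convex_onI)
    fix t u v :: real assume "0 < t" "t < 1" "u \<in> {a..b}" "v \<in> {a..b}"
    then show "- len m ((1 - t) *\<^sub>R u + t *\<^sub>R v) \<le> (1 - t) * - len m u + t * - len m v"
      using cv[of t u v] by simp
  qed auto
  obtain R where R: "R > 0" "\<And>m h. chord m h \<subseteq> {-R..R}" using bounded_chords by blast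
  have "concave_profile (len m) a b (2 * R)"
  proof
    show "a < b" using h1ab by simp
    show "concave_on {a..b} (len m)" by (rule conc)
    show "0 \<le> len m h" for h by (rule len_nonneg)
    show "len m h \<le> 2 * R" for h
    proof (rule chord_interval[of m h])
      fix c d assume "c \<le> d" "chord m h = {c..d}"
      then show ?thesis using R(2)[of m h] by (auto simp: len_def)
    qed (use R in \<open>simp add: len_def\<close>)
    show "0 < len m h" if h: "h \<in> {a<..<b}" for h
    proof (cases h h1 rule: linorder_cases)
      case less
      have "len m a * (h1 - h) + len m h1 * (h - a) \<le> len m h * (h1 - a)"
        using h h1ab less by (intro concave_on_upper_chord[OF conc]) auto
      moreover have "0 < len m h1 * (h - a)" using h h1 by simp
      moreover have "0 \<le> len m a * (h1 - h)" using less len_nonneg by simp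
      ultimately have "0 < len m h * (h1 - a)" by linarith
      then show ?thesis using h1ab by (simp add: zero_less_mult_iff)
    next
      case greater
      have "len m h1 * (b - h) + len m b * (h - h1) \<le> len m h * (b - h1)"
        using h h1ab greater by (intro concave_on_upper_chord[OF conc]) auto
      moreover have "0 < len m h1 * (b - h)" using h h1 by simp
      moreover have "0 \<le> len m b * (h - h1)" using greater len_nonneg by simp
      ultimately have "0 < len m h * (b - h1)" by linarith
      then show ?thesis using h1ab by (simp add: zero_less_mult_iff)
    qed (use h1 in simp)
  qed
  then show ?thesis using out that by blast
qed

section \<open>Moments of the area cut off by a random line\<close>

definition left_area :: "real^2 \<Rightarrow> real^2 \<Rightarrow> ennreal"
  where "left_area p q = emeasure lborel {r \<in> K. 0 < cross_diff p q r}"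

lemma measurable_left_area [measurable (raw)]:
  assumes [measurable]: "f \<in> borel_measurable M" "g \<in> borel_measurable M"
  shows "(\<lambda>x. left_area (f x) (g x)) \<in> borel_measurable M"
proof -
  have "left_area (f x) (g x) = (\<integral>\<^sup>+r. indicator K r * indicator {0<..} (cross_diff (f x) (g x) r) \<partial>lborel)" for x
  proof -
    have "left_area (f x) (g x) = (\<integral>\<^sup>+r. indicator {r \<in> K. 0 < cross_diff (f x) (g x) r} r \<partial>lborel)"
      unfolding left_area_def by (rule nn_integral_indicator[symmetric]) measurable
    then show ?thesis by (simp add: indicator_def of_bool_conj)
  qed
  then show ?thesis by simp
qed

text \<open>Up to the factor \<open>area ^ (k + 2)\<close> this is the \<open>k\<close>-th moment of
  the area fraction to the left of a random line. Values in \<open>ennreal\<close> allow integrals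
  to be exchanged without integrability conditions.\<close>

definition pair_moment :: "nat \<Rightarrow> ennreal"
  where "pair_moment k = (\<integral>\<^sup>+p. \<integral>\<^sup>+q. indicator K p * indicator K q * left_area p q ^ k \<partial>lborel \<partial>lborel)"

definition slope_moment :: "nat \<Rightarrow> real \<Rightarrow> ennreal"
  where "slope_moment k m = (\<integral>\<^sup>+h. \<integral>\<^sup>+x. \<integral>\<^sup>+x'. ennreal \<bar>x' - x\<bar> *
    (indicator K (vec2 x (m * x + h)) * indicator K (vec2 x' (m * x' + h)) *
      left_area (vec2 x (m * x + h)) (vec2 x' (m * x' + h)) ^ k) \<partial>lborel \<partial>lborel \<partial>lborel)"

lemma measurable_slope_moment [measurable]: "slope_moment k \<in> borel_measurable borel"
  unfolding slope_moment_def by measurable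

lemma pair_moment_by_slopes: "pair_moment k = (\<integral>\<^sup>+m. slope_moment k m \<partial>lborel)"
  unfolding pair_moment_def slope_moment_def
  using nn_integral_pairs_by_lines[of "\<lambda>(p, q). indicator K p * indicator K q * left_area p q ^ k"]
  by simp

text \<open>For two points on a line of slope \<open>m\<close>, \<open>cross_diff\<close> is
  \<open>x' - x\<close> times the vertical height of \<open>r\<close> above the line, so the order
  of the abscissae decides which side is the left one. The diagonal has weight 0.\<close>

lemma slope_moment_by_sections:
  "slope_moment k m = (\<integral>\<^sup>+h. ennreal (len m h ^ 3 / 6) *
    ((\<integral>\<^sup>+h'. indicator {h<..} h' * ennreal (len m h') \<partial>lborel) ^ k +
     (\<integral>\<^sup>+h'. indicator {..<h} h' * ennreal (len m h') \<partial>lborel) ^ k) \<partial>lborel)"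
  unfolding slope_moment_def
proof (rule nn_integral_cong)
  fix h :: real
  define U V where "U = (\<integral>\<^sup>+h'. indicator {h<..} h' * ennreal (len m h') \<partial>lborel)"
    and "V = (\<integral>\<^sup>+h'. indicator {..<h} h' * ennreal (len m h') \<partial>lborel)"
  have U: "U = emeasure lborel {r \<in> K. h < r $ 2 - m * r $ 1}"
    unfolding U_def using emeasure_K_slice[of "\<lambda>t. h < t" m] by (simp add: greaterThan_def)
  have V: "V = emeasure lborel {r \<in> K. r $ 2 - m * r $ 1 < h}"
    unfolding V_def using emeasure_K_slice[of "\<lambda>t. t < h" m] by (simp add: lessThan_def)
  have cd: "cross_diff (vec2 x (m * x + h)) (vec2 x' (m * x' + h)) r = (x' - x) * (r $ 2 - m * r $ 1 - h)" for x x' r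
    by (simp add: cross_diff_def algebra_simps)
  have area: "left_area (vec2 x (m * x + h)) (vec2 x' (m * x' + h)) = (if x < x' then U else V)"
    if "x \<noteq> x'" for x x'
  proof -
    have "0 < (x' - x) * (r $ 2 - m * r $ 1 - h) \<longleftrightarrow>
        (if x < x' then h < r $ 2 - m * r $ 1 else r $ 2 - m * r $ 1 < h)" for r :: "real^2"
      using that by (auto simp: zero_less_mult_iff)
    then show ?thesis unfolding left_area_def cd U V by simp
  qed
  have "(\<integral>\<^sup>+x. \<integral>\<^sup>+x'. ennreal \<bar>x' - x\<bar> *
    (indicator K (vec2 x (m * x + h)) * indicator K (vec2 x' (m * x' + h)) *
      left_area (vec2 x (m * x + h)) (vec2 x' (m * x' + h)) ^ k) \<partial>lborel \<partial>lborel) =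
    (\<integral>\<^sup>+x. \<integral>\<^sup>+x'. ennreal \<bar>x' - x\<bar> *
    (indicator (chord m h) x * indicator (chord m h) x' * (if x < x' then U ^ k else V ^ k)) \<partial>lborel \<partial>lborel)"
    (is "_ = ?R")
  proof (intro nn_integral_cong)
    fix x x' :: real
    show "ennreal \<bar>x' - x\<bar> *
      (indicator K (vec2 x (m * x + h)) * indicator K (vec2 x' (m * x' + h)) *
        left_area (vec2 x (m * x + h)) (vec2 x' (m * x' + h)) ^ k) =
      ennreal \<bar>x' - x\<bar> *
      (indicator (chord m h) x * indicator (chord m h) x' * (if x < x' then U ^ k else V ^ k))"
      by (cases "x = x'") (auto simp: area chord_def indicator_def)
  qed
  also have "?R = ennreal (len m h ^ 3 / 6) * (U ^ k + V ^ k)"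
  proof (rule chord_interval[of m h])
    assume "chord m h = {}" then show ?thesis by (simp add: len_def)
  next
    fix c d assume cd: "c \<le> d" "chord m h = {c..d}"
    then show ?thesis using nn_integral_interval_pairs[OF cd(1), of "U ^ k" "V ^ k"] by (simp add: len_def)
  qed
  finally show "(\<integral>\<^sup>+x. \<integral>\<^sup>+x'. ennreal \<bar>x' - x\<bar> *
    (indicator K (vec2 x (m * x + h)) * indicator K (vec2 x' (m * x' + h)) *
      left_area (vec2 x (m * x + h)) (vec2 x' (m * x' + h)) ^ k) \<partial>lborel \<partial>lborel) =
    ennreal (len m h ^ 3 / 6) *
    ((\<integral>\<^sup>+h'. indicator {h<..} h' * ennreal (len m h') \<partial>lborel) ^ k +
     (\<integral>\<^sup>+h'. indicator {..<h} h' * ennreal (len m h') \<partial>lborel) ^ k)"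
    by (simp add: U_def V_def)
qed

definition area :: real
  where "area = measure lborel K"

lemma emeasure_K: "emeasure lborel K = ennreal area"
  unfolding area_def using emeasure_K_finite by (intro emeasure_eq_ennreal_measure) auto

lemma area_pos: "0 < area"
  using emeasure_K_pos by (simp add: emeasure_K)

text \<open>Passage from extended integrals to real moments: the two sides of the line at
  \<open>h\<close> have areas \<open>area * (1 - S h)\<close> and \<open>area * S h\<close>, which
  accounts for the power of \<open>area\<close>.\<close>

lemma slope_moment_eq:
  assumes prof: "concave_profile (len m) a b B" and out: "\<And>h. h \<notin> {a..b} \<Longrightarrow> len m h = 0"
  shows "slope_moment k m = ennreal (area ^ k / 6 * concave_profile.moment (len m) a b k)"
    and "0 \<le> concave_profile.moment (len m) a b k"
proof -
  interpret concave_profile "len m" a b B by (rule prof)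
  have nn: "(\<integral>\<^sup>+h. indicator {u..v} h * ennreal (len m h) \<partial>lborel) = ennreal (integral {u..v} (len m))"
    if "a \<le> u" "v \<le> b" for u v
    using nn_integral_has_integral_lebesgue[of "{u..v}" "len m", OF _ integrable_integral[OF int_L'[OF that]]]
    by (simp add: len_nonneg ennreal_mult' ennreal_indicator)
  have A: "area = integral {a..b} (len m)"
  proof -
    have "ennreal area = (\<integral>\<^sup>+h. indicator {a..b} h * ennreal (len m h) \<partial>lborel)"
      unfolding emeasure_K[symmetric] nn_integral_len[of m, symmetric]
      using out by (intro nn_integral_cong) (auto simp: indicator_def)
    also have "\<dots> = ennreal (integral {a..b} (len m))" by (rule nn) auto
    finally show ?thesis using area_pos integral_pos by (metis ennreal_inj less_imp_le)
  qed
  have U: "(\<integral>\<^sup>+h'. indicator {h<..} h' * ennreal (len m h') \<partial>lborel) = ennreal (area * (1 - S h))"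
    if h: "h \<in> {a..b}" for h
  proof -
    have "AE h' in lborel. indicator {h<..} h' * ennreal (len m h') = indicator {h..b} h' * ennreal (len m h')"
      using AE_lborel_singleton[of h]
    proof eventually_elim
      case (elim h')
      then show ?case using out[of h'] h by (auto simp: indicator_def)
    qed
    then have "(\<integral>\<^sup>+h'. indicator {h<..} h' * ennreal (len m h') \<partial>lborel) = ennreal (integral {h..b} (len m))"
      using nn[of h b] h by (subst nn_integral_cong_AE) auto
    also have "integral {h..b} (len m) = area * (1 - S h)"
      using Henstock_Kurzweil_Integration.integral_combine[of a h b "len m"] int_L h area_pos
      by (simp add: S_def A right_diff_distrib)
    finally show ?thesis .
  qed
  have V: "(\<integral>\<^sup>+h'. indicator {..<h} h' * ennreal (len m h') \<partial>lborel) = ennreal (area * S h)"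
    if h: "h \<in> {a..b}" for h
  proof -
    have "AE h' in lborel. indicator {..<h} h' * ennreal (len m h') = indicator {a..h} h' * ennreal (len m h')"
      using AE_lborel_singleton[of h]
    proof eventually_elim
      case (elim h')
      then show ?case using out[of h'] h by (auto simp: indicator_def)
    qed
    then have "(\<integral>\<^sup>+h'. indicator {..<h} h' * ennreal (len m h') \<partial>lborel) = ennreal (integral {a..h} (len m))"
      using nn[of a h] h by (subst nn_integral_cong_AE) auto
    also have "integral {a..h} (len m) = area * S h"
      using area_pos by (simp add: S_def A)
    finally show ?thesis .
  qed
  define f where "f = (\<lambda>h. area ^ k / 6 * (len m h ^ 3 * (S h ^ k + (1 - S h) ^ k)))"
  have f_nonneg: "0 \<le> f h" if "h \<in> {a..b}" for h
    unfolding f_def using S_bounds[of h] that len_nonneg area_pos by (intro mult_nonneg_nonneg add_nonneg_nonneg zero_le_power) auto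
  have "continuous_on {0..1} (\<lambda>s::real. s ^ k + (1 - s) ^ k)" by (intro continuous_intros)
  from integrable_weighted[OF this, of 3]
  have "(\<lambda>h. len m h ^ 3 * (S h ^ k + (1 - S h) ^ k)) integrable_on {a..b}" .
  from has_integral_mult_right[OF integrable_integral[OF this], of "area ^ k / 6"]
  have f_int: "(f has_integral (area ^ k / 6 * moment k)) {a..b}"
    unfolding f_def moment_def .
  have "slope_moment k m = (\<integral>\<^sup>+h. ennreal (indicator {a..b} h * f h) \<partial>lborel)"
    unfolding slope_moment_by_sections
  proof (rule nn_integral_cong)
    fix h
    show "ennreal (len m h ^ 3 / 6) *
      ((\<integral>\<^sup>+h'. indicator {h<..} h' * ennreal (len m h') \<partial>lborel) ^ k +
       (\<integral>\<^sup>+h'. indicator {..<h} h' * ennreal (len m h') \<partial>lborel) ^ k) = ennreal (indicator {a..b} h * f h)"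
    proof (cases "h \<in> {a..b}")
      case True
      then have "0 \<le> area * (1 - S h)" "0 \<le> area * S h" using S_bounds[of h] area_pos by auto
      then have "ennreal (len m h ^ 3 / 6) * (ennreal (area * (1 - S h)) ^ k + ennreal (area * S h) ^ k) =
         ennreal (len m h ^ 3 / 6 * ((area * (1 - S h)) ^ k + (area * S h) ^ k))"
        using len_nonneg[of m h] ennreal_mult[of "len m h ^ 3 / 6" "(area * (1 - S h)) ^ k + (area * S h) ^ k"]
        by (simp add: ennreal_power)
      also have "len m h ^ 3 / 6 * ((area * (1 - S h)) ^ k + (area * S h) ^ k) = f h"
        unfolding f_def power_mult_distrib by (simp add: algebra_simps)
      finally show ?thesis using True by (simp add: U V)
    qed (simp add: out)
  qed
  also have "\<dots> = ennreal (area ^ k / 6 * moment k)"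
    using f_nonneg f_int by (rule nn_integral_has_integral_lebesgue)
  finally show "slope_moment k m = ennreal (area ^ k / 6 * moment k)" .
  have "0 \<le> area ^ k / 6 * moment k" using f_int f_nonneg by (rule has_integral_nonneg)
  moreover have "0 < area ^ k / 6" using area_pos by simp
  ultimately show "0 \<le> moment k" unfolding zero_le_mult_iff by linarith
qed

text \<open>A rescaled \<open>moment_less\<close>: \<open>slope_moment (n - 1)\<close> carries one
  more power of \<open>area\<close> than \<open>slope_moment (n - 2)\<close>, and the factor
  \<open>area\<close> on the left balances it.\<close>

lemma slope_moment_less:
  assumes n: "n \<ge> 2"
  shows "ennreal (real (n - 1) * area) * slope_moment (n - 2) m < ennreal (real (n + 1)) * slope_moment (n - 1) m"
proof -
  obtain a b B where prof: "concave_profile (len m) a b B" and out: "\<And>h. h \<notin> {a..b} \<Longrightarrow> len m h = 0"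
    using concave_profile_len[of m] by blast
  interpret concave_profile "len m" a b B by (rule prof)
  have eq: "slope_moment k m = ennreal (area ^ k / 6 * moment k)" "0 \<le> moment k" for k
    using slope_moment_eq[OF prof] out by auto
  have "area ^ (n - 1) / 6 * (real (n - 1) * moment (n - 2)) < area ^ (n - 1) / 6 * (real (n + 1) * moment (n - 1))"
    using moment_less[OF n] area_pos by (intro mult_strict_left_mono) auto
  moreover have "n - 1 = Suc (n - 2)" using n by simp
  ultimately have *: "real (n - 1) * area * (area ^ (n - 2) / 6 * moment (n - 2)) <
      real (n + 1) * (area ^ (n - 1) / 6 * moment (n - 1))"
    by (simp only: power_Suc mult_ac times_divide_eq_left times_divide_eq_right)
  have "ennreal (real (n - 1) * area) * slope_moment (n - 2) m =
      ennreal (real (n - 1) * area * (area ^ (n - 2) / 6 * moment (n - 2)))"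
    unfolding eq(1) using area_pos eq(2) by (subst ennreal_mult[symmetric]) auto
  also have "\<dots> < ennreal (real (n + 1) * (area ^ (n - 1) / 6 * moment (n - 1)))"
    using * area_pos eq(2) by (subst ennreal_less_iff) auto
  also have "\<dots> = ennreal (real (n + 1)) * slope_moment (n - 1) m"
    unfolding eq(1) using area_pos eq(2) by (subst ennreal_mult[symmetric]) auto
  finally show ?thesis .
qed

lemma left_area_le: "left_area p q \<le> ennreal area"
  unfolding left_area_def emeasure_K[symmetric] by (intro emeasure_mono) auto

text \<open>Finiteness is what lets a strict inequality at every slope survive integration over the
  slopes.\<close>

lemma pair_moment_finite: "pair_moment k < \<infinity>"
proof -
  have "pair_moment k \<le> (\<integral>\<^sup>+p. \<integral>\<^sup>+q. ennreal area ^ k * (indicator K p * indicator K q) \<partial>lborel \<partial>lborel)"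
    unfolding pair_moment_def using power_mono[OF left_area_le zero_le]
    by (intro nn_integral_mono) (auto simp: indicator_def)
  also have "\<dots> = ennreal area ^ k * (ennreal area * ennreal area)"
    by (simp add: nn_integral_cmult nn_integral_multc emeasure_K)
  also have "\<dots> < \<infinity>" by (simp add: ennreal_mult_less_top power_less_top_ennreal)
  finally show ?thesis .
qed

theorem pair_moment_less:
  assumes n: "n \<ge> 2"
  shows "ennreal (real (n - 1) * area) * pair_moment (n - 2) < ennreal (real (n + 1)) * pair_moment (n - 1)"
proof -
  have "ennreal (real (n - 1) * area) * pair_moment (n - 2) =
      (\<integral>\<^sup>+m. ennreal (real (n - 1) * area) * slope_moment (n - 2) m \<partial>lborel)"
    by (simp add: pair_moment_by_slopes nn_integral_cmult)
  also have "\<dots> < (\<integral>\<^sup>+m. ennreal (real (n + 1)) * slope_moment (n - 1) m \<partial>lborel)"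
  proof (rule nn_integral_less)
    show "(\<integral>\<^sup>+m. ennreal (real (n - 1) * area) * slope_moment (n - 2) m \<partial>lborel) \<noteq> \<infinity>"
      using pair_moment_finite[of "n - 2"]
      by (simp add: nn_integral_cmult ennreal_mult_eq_top_iff flip: pair_moment_by_slopes)
    show "\<not> (AE m in lborel. ennreal (real (n + 1)) * slope_moment (n - 1) m \<le> ennreal (real (n - 1) * area) * slope_moment (n - 2) m)"
    proof
      assume "AE m in lborel. ennreal (real (n + 1)) * slope_moment (n - 1) m \<le> ennreal (real (n - 1) * area) * slope_moment (n - 2) m"
      then have "AE m in (lborel :: real measure). False"
        using slope_moment_less[OF n] by (simp add: not_le[symmetric])
      then show False by (simp add: eventually_False ae_filter_eq_bot_iff)
    qed
  qed (use slope_moment_less[OF n] in \<open>auto intro: less_imp_le\<close>)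
  also have "\<dots> = ennreal (real (n + 1)) * pair_moment (n - 1)"
    by (simp add: pair_moment_by_slopes nn_integral_cmult)
  finally show ?thesis .
qed

end

section \<open>Random points\<close>

text \<open>Strict separation of a point from a finite set is an open condition on the direction, so
  a countable dense set of directions suffices. Being a vertex thereby becomes a countable
  combination of measurable conditions.\<close>

lemma countable_separating_directions:
  obtains D :: "'a::euclidean_space set" where "countable D"
    "\<And>T v. finite T \<Longrightarrow> v \<notin> convex hull T \<longleftrightarrow> (\<exists>u\<in>D. \<forall>t\<in>T. u \<bullet> v < u \<bullet> t)"
proof -
  obtain D :: "'a set" where D: "countable D" "\<And>X. open X \<Longrightarrow> X \<noteq> {} \<Longrightarrow> \<exists>d\<in>D. d \<in> X"
    using countable_dense_exists by blast
  have "v \<notin> convex hull T \<longleftrightarrow> (\<exists>u\<in>D. \<forall>t\<in>T. u \<bullet> v < u \<bullet> t)" if fin: "finite T" for T and v :: 'a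
  proof
    assume "v \<notin> convex hull T"
    moreover have "closed (convex hull T)"
      using fin by (intro compact_imp_closed finite_imp_compact_convex_hull)
    ultimately obtain u b where ub: "u \<bullet> v < b" "\<And>y. y \<in> convex hull T \<Longrightarrow> b < u \<bullet> y"
      using separating_hyperplane_closed_point[OF convex_convex_hull] by metis
    have "open (\<Inter>t\<in>T. {u. u \<bullet> v < u \<bullet> t})"
      using fin by (intro open_INT ballI open_Collect_less continuous_intros)
    moreover have "u \<in> (\<Inter>t\<in>T. {u. u \<bullet> v < u \<bullet> t})"
      using ub by (fastforce intro: hull_inc)
    ultimately obtain d where "d \<in> D" "d \<in> (\<Inter>t\<in>T. {u. u \<bullet> v < u \<bullet> t})"
      using D(2)[of "\<Inter>t\<in>T. {u. u \<bullet> v < u \<bullet> t}"] by blast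
    then show "\<exists>u\<in>D. \<forall>t\<in>T. u \<bullet> v < u \<bullet> t" by auto
  next
    assume "\<exists>u\<in>D. \<forall>t\<in>T. u \<bullet> v < u \<bullet> t"
    then obtain u where "T \<subseteq> {x. u \<bullet> x > u \<bullet> v}" by auto
    then have "convex hull T \<subseteq> {x. u \<bullet> x > u \<bullet> v}"
      by (rule hull_minimal) (rule convex_halfspace_gt)
    then show "v \<notin> convex hull T" by auto
  qed
  with D(1) that show ?thesis by blast
qed

text \<open>Turns segment membership into an equation between measurable functions.\<close>

lemma mem_closed_segment_iff_dist:
  "r \<in> closed_segment p q \<longleftrightarrow> dist p q = dist p r + dist r q" for p q r :: "'a::euclidean_space"
  by (simp add: between flip: between_mem_segment)

lemma pred_eq_metric [measurable (raw)]:
  fixes f g :: "'b \<Rightarrow> 'a::{metric_space, second_countable_topology}"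
  assumes [measurable]: "f \<in> borel_measurable M" "g \<in> borel_measurable M"
  shows "Measurable.pred M (\<lambda>x. f x = g x)"
proof -
  have "Measurable.pred M (\<lambda>x. dist (f x) (g x) = 0)" by measurable
  then show ?thesis by simp
qed

text \<open>Coincident sample points are covered by weighting indices with reciprocal
  multiplicities; the test for a vertex runs over countably many directions.\<close>

lemma measurable_num_faces_0:
  fixes I :: "'i set" and M :: "'i \<Rightarrow> (real^2) measure"
  assumes fin: "finite I" and M: "\<And>i. sets (M i) = sets borel"
  shows "(\<lambda>x. real (num_faces 0 (convex hull (x ` I)))) \<in> borel_measurable (PiM I M)"
proof -
  note [measurable_cong] = M
  obtain D :: "(real^2) set" where D: "countable D"
    "\<And>T v. finite T \<Longrightarrow> v \<notin> convex hull T \<longleftrightarrow> (\<exists>u\<in>D. \<forall>t\<in>T. u \<bullet> v < u \<bullet> t)"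
    using countable_separating_directions by metis
  have "real (num_faces 0 (convex hull (x ` I))) =
    (\<Sum>i\<in>I. if \<exists>u\<in>D. \<forall>j\<in>I. x j = x i \<or> u \<bullet> x i < u \<bullet> x j
      then 1 / (\<Sum>j\<in>I. if x j = x i then 1 else 0) else 0)" for x :: "'i \<Rightarrow> real^2"
  proof -
    have "x i \<notin> convex hull (x ` I - {x i}) \<longleftrightarrow> (\<exists>u\<in>D. \<forall>j\<in>I. x j = x i \<or> u \<bullet> x i < u \<bullet> x j)" for i
      using D(2)[of "x ` I - {x i}" "x i"] fin by auto
    moreover have "real (card {j \<in> I. x j = x i}) = (\<Sum>j\<in>I. if x j = x i then 1 else 0)" for i
      using fin by (simp add: sum.If_cases Int_def)
    ultimately show ?thesis
      using card_image_weighted[OF fin, of x "\<lambda>v. v \<notin> convex hull (x ` I - {v})"] fin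
      by (simp add: num_faces_0_convex_hull cong: if_cong)
  qed
  moreover have "(\<lambda>x. \<Sum>i\<in>I. if \<exists>u\<in>D. \<forall>j\<in>I. x j = x i \<or> u \<bullet> x i < u \<bullet> x j
      then 1 / (\<Sum>j\<in>I. if x j = x i then 1 else 0 :: real) else 0) \<in> borel_measurable (PiM I M)"
  proof (intro borel_measurable_sum measurable_If borel_measurable_divide borel_measurable_const)
    fix i assume [measurable]: "i \<in> I"
    show "{x \<in> space (PiM I M). \<exists>u\<in>D. \<forall>j\<in>I. x j = x i \<or> u \<bullet> x i < u \<bullet> x j} \<in> sets (PiM I M)"
    proof (intro sets.sets_Collect_countable_Ex' sets.sets_Collect_finite_All' D(1) fin)
      fix u j assume [measurable]: "j \<in> I"
      show "{x \<in> space (PiM I M). x j = x i \<or> u \<bullet> x i < u \<bullet> x j} \<in> sets (PiM I M)" by measurable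
    qed (use \<open>i \<in> I\<close> in auto)
    show "{x \<in> space (PiM I M). x j = x i} \<in> sets (PiM I M)" if [measurable]: "j \<in> I" for j
      by measurable
  qed
  ultimately show ?thesis by simp
qed

lemma measurable_num_faces_1:
  fixes I :: "'i set" and M :: "'i \<Rightarrow> (real^2) measure"
  assumes fin: "finite I" and M: "\<And>i. sets (M i) = sets borel"
  shows "(\<lambda>x. real (num_faces 1 (convex hull (x ` I)))) \<in> borel_measurable (PiM I M)"
proof -
  note [measurable_cong] = M
  \<comment> \<open>\<open>spans_edge\<close> for two distinct sample points, with quantifiers over
    indices and segment membership expressed by distances.\<close>
  define Q where "Q = (\<lambda>x i j. x i \<noteq> x j \<and>
    ((\<forall>k\<in>I. 0 \<le> cross_diff (x i) (x j) (x k)) \<or> (\<forall>k\<in>I. cross_diff (x i) (x j) (x k) \<le> 0)) \<and>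
    (\<forall>k\<in>I. cross_diff (x i) (x j) (x k) = 0 \<longrightarrow> dist (x i) (x j) = dist (x i) (x k) + dist (x k) (x j)))"
  have "real (num_faces 1 (convex hull (x ` I))) =
    (\<Sum>e\<in>I \<times> I. if Q x (fst e) (snd e)
      then 1 / (\<Sum>e'\<in>I \<times> I. if x (fst e') = x (fst e) \<and> x (snd e') = x (snd e) then 1 else 0) else 0) / 2"
    for x :: "'i \<Rightarrow> real^2"
  proof -
    have "real (card {(p, q) \<in> x ` I \<times> x ` I. p \<noteq> q \<and> spans_edge (x ` I) p q}) =
      real (card {e \<in> map_prod x x ` (I \<times> I). fst e \<noteq> snd e \<and> spans_edge (x ` I) (fst e) (snd e)})"
      by (rule arg_cong[where f = "\<lambda>A. real (card A)"]) (auto simp: map_prod_surj_on)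
    also have "\<dots> = (\<Sum>e\<in>I \<times> I. if Q x (fst e) (snd e)
      then 1 / real (card {e'\<in>I \<times> I. map_prod x x e' = map_prod x x e}) else 0)"
      using fin by (subst card_image_weighted) (auto simp: Q_def spans_edge_def mem_closed_segment_iff_dist intro!: sum.cong)
    also have "\<dots> = (\<Sum>e\<in>I \<times> I. if Q x (fst e) (snd e)
      then 1 / (\<Sum>e'\<in>I \<times> I. if x (fst e') = x (fst e) \<and> x (snd e') = x (snd e) then 1 else 0) else 0)"
    proof (rule sum.cong)
      fix e
      have "{e'\<in>I \<times> I. map_prod x x e' = map_prod x x e} =
        {e' \<in> I \<times> I. x (fst e') = x (fst e) \<and> x (snd e') = x (snd e)}"
        by (auto simp: map_prod_def split: prod.splits)
      then have "real (card {e'\<in>I \<times> I. map_prod x x e' = map_prod x x e}) =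
        (\<Sum>e'\<in>I \<times> I. if x (fst e') = x (fst e) \<and> x (snd e') = x (snd e) then 1 else 0)"
        using fin by (simp add: sum.If_cases Int_def)
      then show "(if Q x (fst e) (snd e) then 1 / real (card {e'\<in>I \<times> I. map_prod x x e' = map_prod x x e}) else 0) =
        (if Q x (fst e) (snd e)
      then 1 / (\<Sum>e'\<in>I \<times> I. if x (fst e') = x (fst e) \<and> x (snd e') = x (snd e) then 1 else 0) else 0)"
        by simp
    qed simp
    finally show ?thesis using num_faces_1_convex_hull[of "x ` I"] fin by simp
  qed
  moreover have "(\<lambda>x. (\<Sum>e\<in>I \<times> I. if Q x (fst e) (snd e)
      then 1 / (\<Sum>e'\<in>I \<times> I. if x (fst e') = x (fst e) \<and> x (snd e') = x (snd e) then 1 else 0) else 0) / 2 :: real)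
    \<in> borel_measurable (PiM I M)"
  proof (intro borel_measurable_divide borel_measurable_sum measurable_If borel_measurable_const)
    fix e assume "e \<in> I \<times> I"
    then have [measurable]: "fst e \<in> I" "snd e \<in> I" by auto
    show "{x \<in> space (PiM I M). x (fst e') = x (fst e) \<and> x (snd e') = x (snd e)} \<in> sets (PiM I M)" if "e' \<in> I \<times> I" for e'
    proof -
      have [measurable]: "fst e' \<in> I" "snd e' \<in> I" using that by auto
      show ?thesis by measurable
    qed
    have all: "Measurable.pred (PiM I M) (\<lambda>x. \<forall>k\<in>I. R x (x k))"
      if "\<And>k. k \<in> I \<Longrightarrow> Measurable.pred (PiM I M) (\<lambda>x. R x (x k))" for R
      using fin that by (rule pred_intros_finite(3))
    have [measurable]: "Measurable.pred (PiM I M) (\<lambda>x. \<forall>k\<in>I. 0 \<le> cross_diff (x (fst e)) (x (snd e)) (x k))"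
    proof (rule all)
      fix k assume [measurable]: "k \<in> I"
      show "Measurable.pred (PiM I M) (\<lambda>x. 0 \<le> cross_diff (x (fst e)) (x (snd e)) (x k))" by measurable
    qed
    have [measurable]: "Measurable.pred (PiM I M) (\<lambda>x. \<forall>k\<in>I. cross_diff (x (fst e)) (x (snd e)) (x k) \<le> 0)"
    proof (rule all)
      fix k assume [measurable]: "k \<in> I"
      show "Measurable.pred (PiM I M) (\<lambda>x. cross_diff (x (fst e)) (x (snd e)) (x k) \<le> 0)" by measurable
    qed
    have [measurable]: "Measurable.pred (PiM I M) (\<lambda>x. \<forall>k\<in>I. cross_diff (x (fst e)) (x (snd e)) (x k) = 0 \<longrightarrow>
        dist (x (fst e)) (x (snd e)) = dist (x (fst e)) (x k) + dist (x k) (x (snd e)))"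
    proof (rule all)
      fix k assume [measurable]: "k \<in> I"
      show "Measurable.pred (PiM I M) (\<lambda>x. cross_diff (x (fst e)) (x (snd e)) (x k) = 0 \<longrightarrow>
          dist (x (fst e)) (x (snd e)) = dist (x (fst e)) (x k) + dist (x k) (x (snd e)))" by measurable
    qed
    show "{x \<in> space (PiM I M). Q x (fst e) (snd e)} \<in> sets (PiM I M)"
      unfolding Q_def by measurable
  qed
  ultimately show ?thesis by (simp only:)
qed

section \<open>General position holds almost surely\<close>

lemma AE_lborel_cross_diff:
  assumes "p \<noteq> q" shows "AE r in lborel. cross_diff p q r \<noteq> 0"
proof -
  define a where "a = (vector [p $ 2 - q $ 2, q $ 1 - p $ 1] :: real^2)"
  have "a \<noteq> 0" using assms by (auto simp: a_def vec_eq_iff forall_2 vector_2)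
  then have "{r. a \<bullet> r = a \<bullet> p} \<in> null_sets (completion lborel)"
    using negligible_hyperplane[of a "a \<bullet> p"] by (simp add: negligible_iff_null_sets)
  moreover have "{r. a \<bullet> r = a \<bullet> p} \<in> sets lborel" by measurable
  ultimately have "{r. a \<bullet> r = a \<bullet> p} \<in> null_sets lborel" using null_sets_completion_iff by blast
  from AE_not_in[OF this] show ?thesis by (simp add: cross_diff_eq_inner a_def)
qed

text \<open>Tonelli for null sets: the exceptional set is integrated over coordinate
  \<open>k\<close> first, where it is null for almost every choice of the other coordinates.\<close>

lemma (in product_sigma_finite) AE_PiM_insertI:
  assumes "finite I" "k \<notin> I" and meas: "{x \<in> space (PiM (insert k I) M). P x} \<in> sets (PiM (insert k I) M)"
    and AE: "AE x in PiM I M. AE y in M k. P (x(k := y))"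
  shows "AE x in PiM (insert k I) M. P x"
proof -
  define f where "f = (\<lambda>x. indicator (space (PiM (insert k I) M) - {x \<in> space (PiM (insert k I) M). P x}) x :: ennreal)"
  have f: "f \<in> borel_measurable (PiM (insert k I) M)"
    unfolding f_def using meas by (intro borel_measurable_indicator) auto
  have "(\<integral>\<^sup>+x. f x \<partial>PiM (insert k I) M) = (\<integral>\<^sup>+x. \<integral>\<^sup>+y. f (x(k := y)) \<partial>M k \<partial>PiM I M)"
    using assms(1,2) f by (rule product_nn_integral_insert)
  also have "\<dots> = (\<integral>\<^sup>+x. \<integral>\<^sup>+y. 0 \<partial>M k \<partial>PiM I M)"
  proof (rule nn_integral_cong_AE)
    show "AE x in PiM I M. (\<integral>\<^sup>+y. f (x(k := y)) \<partial>M k) = (\<integral>\<^sup>+y. 0 \<partial>M k)"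
      using AE
    proof eventually_elim
      case (elim x)
      then have "AE y in M k. f (x(k := y)) = 0" by eventually_elim (simp add: f_def)
      then show ?case by (rule nn_integral_cong_AE)
    qed
  qed
  finally have "AE x in PiM (insert k I) M. f x = 0"
    using f by (simp add: nn_integral_0_iff_AE)
  with AE_space show ?thesis by eventually_elim (auto simp: f_def indicator_def split: if_splits)
qed

context planar_convex_body
begin

abbreviation \<mu> :: "(real^2) measure"
  where "\<mu> \<equiv> uniform_measure lborel K"

abbreviation sample :: "nat set \<Rightarrow> (nat \<Rightarrow> real^2) measure"
  where "sample I \<equiv> PiM I (\<lambda>_. \<mu>)"

lemma prob_space_\<mu>: "prob_space \<mu>"
  using emeasure_K_pos emeasure_K_finite by (intro prob_space_uniform_measure) auto

sublocale U: product_prob_space "\<lambda>_::nat. \<mu>" UNIV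
  by (intro product_prob_spaceI prob_space_\<mu>)

lemma prob_space_sample: "prob_space (sample I)"
  by (intro prob_space_PiM prob_space_\<mu>)

lemma AE_\<mu>I: "AE x in lborel. P x \<Longrightarrow> AE x in \<mu>. P x"
  by (intro AE_uniform_measureI) auto

lemma AE_sample_neq:
  assumes fin: "finite I" and ij: "i \<in> I" "j \<in> I" "i \<noteq> j"
  shows "AE x in sample I. x i \<noteq> x j"
proof -
  have I: "insert j (I - {j}) = I" using ij by auto
  have "AE x in sample (insert j (I - {j})). x i \<noteq> x j"
  proof (rule U.AE_PiM_insertI)
    have [measurable]: "i \<in> insert j (I - {j})" "j \<in> insert j (I - {j})" using ij by auto
    show "{x \<in> space (sample (insert j (I - {j}))). x i \<noteq> x j} \<in> sets (sample (insert j (I - {j})))"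
      by measurable
    show "AE x in sample (I - {j}). AE y in \<mu>. (x(j := y)) i \<noteq> (x(j := y)) j"
    proof (rule AE_I2, rule AE_\<mu>I)
      fix x
      have "AE y in lborel. y \<noteq> x i" by (rule AE_lborel_singleton)
      then show "AE y in lborel. (x(j := y)) i \<noteq> (x(j := y)) j" using ij by (auto elim: eventually_mono)
    qed
  qed (use fin in auto)
  then show ?thesis by (simp only: I)
qed

text \<open>The point \<open>x k\<close> is drawn last: once \<open>x i\<close> and
  \<open>x j\<close> differ, it has to avoid a single line, which is a null set.\<close>

lemma AE_sample_cross_diff:
  assumes fin: "finite I" and ijk: "i \<in> I" "j \<in> I" "k \<in> I" "i \<noteq> j" "k \<noteq> i" "k \<noteq> j"
  shows "AE x in sample I. cross_diff (x i) (x j) (x k) \<noteq> 0"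
proof -
  have I: "insert k (I - {k}) = I" using ijk by auto
  have "AE x in sample (insert k (I - {k})). cross_diff (x i) (x j) (x k) \<noteq> 0"
  proof (rule U.AE_PiM_insertI)
    have [measurable]: "i \<in> insert k (I - {k})" "j \<in> insert k (I - {k})" "k \<in> insert k (I - {k})" using ijk by auto
    show "{x \<in> space (sample (insert k (I - {k}))). cross_diff (x i) (x j) (x k) \<noteq> 0} \<in> sets (sample (insert k (I - {k})))"
      by measurable
    have "AE x in sample (I - {k}). x i \<noteq> x j" using fin ijk by (intro AE_sample_neq) auto
    then show "AE x in sample (I - {k}). AE y in \<mu>. cross_diff ((x(k := y)) i) ((x(k := y)) j) ((x(k := y)) k) \<noteq> 0"
    proof eventually_elim
      case (elim x)
      show ?case using ijk by (simp add: AE_\<mu>I[OF AE_lborel_cross_diff[OF elim]])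
    qed
  qed (use fin in auto)
  then show ?thesis by (simp only: I)
qed

lemma AE_general_position:
  assumes fin: "finite I"
  shows "AE x in sample I. general_position I x"
proof -
  have "AE x in sample I. \<forall>i\<in>I. \<forall>j\<in>I - {i}. x i \<noteq> x j"
    using fin by (intro AE_finite_allI AE_sample_neq) auto
  moreover have "AE x in sample I. \<forall>i\<in>I. \<forall>j\<in>I - {i}. \<forall>k\<in>I - {i, j}. cross_diff (x i) (x j) (x k) \<noteq> 0"
    using fin by (intro AE_finite_allI AE_sample_cross_diff) auto
  ultimately show ?thesis
    by eventually_elim (auto simp: general_position_def inj_on_def)
qed

section \<open>Expected number of oriented boundary edges\<close>

lemma nn_integral_\<mu>:
  "f \<in> borel_measurable borel \<Longrightarrow> (\<integral>\<^sup>+x. f x \<partial>\<mu>) = (\<integral>\<^sup>+x. f x * indicator K x \<partial>lborel) / ennreal area"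
  by (subst nn_integral_uniform_measure) (auto simp: emeasure_K)

lemma nn_integral_\<mu>_left: "(\<integral>\<^sup>+r. indicator {0<..} (cross_diff p q r) \<partial>\<mu>) = left_area p q / ennreal area"
proof -
  have "(\<integral>\<^sup>+r. indicator {0<..} (cross_diff p q r) \<partial>\<mu>) =
      (\<integral>\<^sup>+r. indicator {0<..} (cross_diff p q r) * indicator K r \<partial>lborel) / ennreal area"
    by (rule nn_integral_\<mu>) measurable
  also have "(\<integral>\<^sup>+r. indicator {0<..} (cross_diff p q r) * indicator K r \<partial>lborel) =
      (\<integral>\<^sup>+r. indicator {r \<in> K. 0 < cross_diff p q r} r \<partial>lborel)"
    by (intro nn_integral_cong) (auto simp: indicator_def)
  also have "\<dots> = left_area p q" unfolding left_area_def by (rule nn_integral_indicator) measurable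
  finally show ?thesis .
qed

text \<open>Two powers of \<open>area\<close> come from the densities of \<open>p\<close> and
  \<open>q\<close>, the other \<open>k\<close> from the fractions.\<close>

lemma nn_integral_pair_\<mu>:
  "(\<integral>\<^sup>+p. \<integral>\<^sup>+q. (left_area p q / ennreal area) ^ k \<partial>\<mu> \<partial>\<mu>) = pair_moment k / ennreal (area ^ (k + 2))"
proof -
  define c where "c = inverse (ennreal area)"
  have div: "x / ennreal area = c * x" for x by (simp add: c_def divide_ennreal_def mult.commute)
  have "(\<integral>\<^sup>+p. \<integral>\<^sup>+q. (left_area p q / ennreal area) ^ k \<partial>\<mu> \<partial>\<mu>) =
      (\<integral>\<^sup>+p. (\<integral>\<^sup>+q. (c * left_area p q) ^ k \<partial>\<mu>) * indicator K p \<partial>lborel) / ennreal area"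
    unfolding div[of "left_area _ _"]
  proof (rule nn_integral_\<mu>)
    have [measurable_cong]: "sets \<mu> = sets borel" by simp
    show "(\<lambda>p. \<integral>\<^sup>+q. (c * left_area p q) ^ k \<partial>\<mu>) \<in> borel_measurable borel"
      by (rule U.M.borel_measurable_nn_integral) measurable
  qed
  also have "\<dots> = (\<integral>\<^sup>+p. ((\<integral>\<^sup>+q. (c * left_area p q) ^ k * indicator K q \<partial>lborel) / ennreal area) * indicator K p \<partial>lborel) / ennreal area"
    by (subst nn_integral_\<mu>) auto
  also have "\<dots> = (\<integral>\<^sup>+p. c ^ (k + 1) * (\<integral>\<^sup>+q. indicator K p * indicator K q * left_area p q ^ k \<partial>lborel) \<partial>lborel) * c"
    unfolding div
    by (simp add: power_mult_distrib mult_ac flip: nn_integral_cmult)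
  also have "\<dots> = c ^ (k + 2) * pair_moment k"
    unfolding pair_moment_def by (subst nn_integral_cmult) (auto simp: mult_ac)
  also have "c ^ (k + 2) = inverse (ennreal (area ^ (k + 2)))"
    using area_pos by (simp only: c_def ennreal_inverse_power[symmetric] ennreal_power less_imp_le)
  finally show ?thesis by (simp only: divide_ennreal_def mult.commute)
qed

text \<open>With \<open>x i\<close> and \<open>x j\<close> fixed, the remaining points are
  independent and each falls to the left with the same probability, the area fraction there, so the
  product integrates to a power of it.\<close>

lemma nn_integral_ccw_edge:
  assumes fin: "finite I" and ij: "i \<in> I" "j \<in> I" "i \<noteq> j"
  shows "(\<integral>\<^sup>+x. (\<Prod>k\<in>I - {i, j}. indicator {0<..} (cross_diff (x i) (x j) (x k))) \<partial>sample I) =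
    pair_moment (card I - 2) / ennreal (area ^ card I)"
proof -
  define J where "J = I - {i, j}"
  have I: "I = {i, j} \<union> J" and disj: "{i, j} \<inter> J = {}" using ij by (auto simp: J_def)
  have finJ: "finite J" using fin by (simp add: J_def)
  have cardJ: "card J = card I - 2" "card I = card J + 2"
    using fin ij card_mono[OF fin, of "{i, j}"] by (auto simp: J_def card_Diff_subset)
  have [measurable_cong]: "sets \<mu> = sets borel" by simp
  have "(\<integral>\<^sup>+x. (\<Prod>k\<in>J. indicator {0<..} (cross_diff (x i) (x j) (x k))) \<partial>sample ({i, j} \<union> J)) =
    (\<integral>\<^sup>+x. \<integral>\<^sup>+y. (\<Prod>k\<in>J. indicator {0<..} (cross_diff (merge {i, j} J (x, y) i) (merge {i, j} J (x, y) j) (merge {i, j} J (x, y) k)))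
      \<partial>sample J \<partial>sample {i, j})"
  proof (rule U.product_nn_integral_fold[OF disj _ finJ])
    show "(\<lambda>x. \<Prod>k\<in>J. indicator {0<..} (cross_diff (x i) (x j) (x k)) :: ennreal) \<in> borel_measurable (sample ({i, j} \<union> J))"
    proof (rule borel_measurable_prod_ennreal)
      fix k assume "k \<in> J"
      then have [measurable]: "i \<in> {i, j} \<union> J" "j \<in> {i, j} \<union> J" "k \<in> {i, j} \<union> J" by auto
      show "(\<lambda>x. indicator {0<..} (cross_diff (x i) (x j) (x k)) :: ennreal) \<in> borel_measurable (sample ({i, j} \<union> J))"
        by measurable
    qed
  qed simp
  also have "\<dots> = (\<integral>\<^sup>+x. \<integral>\<^sup>+y. (\<Prod>k\<in>J. indicator {0<..} (cross_diff (x i) (x j) (y k))) \<partial>sample J \<partial>sample {i, j})"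
    using disj by (intro nn_integral_cong prod.cong) auto
  also have "\<dots> = (\<integral>\<^sup>+x. (left_area (x i) (x j) / ennreal area) ^ card J \<partial>sample {i, j})"
  proof (intro nn_integral_cong)
    fix x
    have "(\<integral>\<^sup>+y. (\<Prod>k\<in>J. indicator {0<..} (cross_diff (x i) (x j) (y k))) \<partial>sample J) =
      (\<Prod>k\<in>J. \<integral>\<^sup>+r. indicator {0<..} (cross_diff (x i) (x j) r) \<partial>\<mu>)"
      by (rule U.product_nn_integral_prod[OF finJ]) measurable
    then show "(\<integral>\<^sup>+y. (\<Prod>k\<in>J. indicator {0<..} (cross_diff (x i) (x j) (y k))) \<partial>sample J) =
      (left_area (x i) (x j) / ennreal area) ^ card J"
      by (simp add: nn_integral_\<mu>_left)
  qed
  also have "\<dots> = (\<integral>\<^sup>+z. (left_area (fst z) (snd z) / ennreal area) ^ card J \<partial>(\<mu> \<Otimes>\<^sub>M \<mu>))"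
    using ij by (intro U.product_nn_integral_pair[where f = "\<lambda>p q. (left_area p q / ennreal area) ^ card J"]) measurable
  also have "\<dots> = (\<integral>\<^sup>+p. \<integral>\<^sup>+q. (left_area p q / ennreal area) ^ card J \<partial>\<mu> \<partial>\<mu>)"
  proof -
    have "(\<lambda>z. (left_area (fst z) (snd z) / ennreal area) ^ card J) \<in> borel_measurable (\<mu> \<Otimes>\<^sub>M \<mu>)"
      by measurable
    from U.M.nn_integral_fst[OF this] show ?thesis by simp
  qed
  also have "\<dots> = pair_moment (card J) / ennreal (area ^ (card J + 2))"
    by (rule nn_integral_pair_\<mu>)
  finally show ?thesis
    by (simp only: J_def[symmetric] I[symmetric] cardJ(1)[symmetric] cardJ(2)[symmetric])
qed

lemma nn_integral_card_ccw_edges: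
  assumes fin: "finite I"
  shows "(\<integral>\<^sup>+x. of_nat (card (ccw_edges I x)) \<partial>sample I) =
    of_nat (card I * (card I - 1)) * (pair_moment (card I - 2) / ennreal (area ^ card I))"
proof -
  define P where "P = {e \<in> I \<times> I. fst e \<noteq> snd e}"
  have finP: "finite P" unfolding P_def using fin by simp
  have cardP: "card P = card I * (card I - 1)"
  proof -
    have "P = (SIGMA i:I. I - {i})" by (auto simp: P_def)
    then show ?thesis using fin by (simp add: card_Diff_singleton)
  qed
  have [measurable_cong]: "sets \<mu> = sets borel" by simp
  have eq: "of_nat (card (ccw_edges I x)) =
    (\<Sum>e\<in>P. \<Prod>k\<in>I - {fst e, snd e}. indicator {0<..} (cross_diff (x (fst e)) (x (snd e)) (x k)) :: ennreal)" for x
  proof -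
    have "(\<Prod>k\<in>J. indicator {0<..} (f k) :: ennreal) = (if \<forall>k\<in>J. 0 < f k then 1 else 0)"
      if "finite J" for J and f :: "nat \<Rightarrow> real"
      using that by (induction J) (auto simp: indicator_def)
    then have "(\<Sum>e\<in>P. \<Prod>k\<in>I - {fst e, snd e}. indicator {0<..} (cross_diff (x (fst e)) (x (snd e)) (x k)) :: ennreal) =
      (\<Sum>e\<in>P. if \<forall>k\<in>I - {fst e, snd e}. 0 < cross_diff (x (fst e)) (x (snd e)) (x k) then 1 else 0)"
      using fin by simp
    also have "\<dots> = of_nat (card {e \<in> P. \<forall>k\<in>I - {fst e, snd e}. 0 < cross_diff (x (fst e)) (x (snd e)) (x k)})"
      using finP by (simp add: sum.If_cases Int_def)
    also have "{e \<in> P. \<forall>k\<in>I - {fst e, snd e}. 0 < cross_diff (x (fst e)) (x (snd e)) (x k)} = ccw_edges I x"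
      by (auto simp: P_def ccw_edges_def)
    finally show ?thesis ..
  qed
  have "(\<integral>\<^sup>+x. of_nat (card (ccw_edges I x)) \<partial>sample I) =
    (\<Sum>e\<in>P. \<integral>\<^sup>+x. (\<Prod>k\<in>I - {fst e, snd e}. indicator {0<..} (cross_diff (x (fst e)) (x (snd e)) (x k))) \<partial>sample I)"
    unfolding eq
  proof (rule nn_integral_sum)
    fix e assume "e \<in> P"
    then have [measurable]: "fst e \<in> I" "snd e \<in> I" by (auto simp: P_def)
    show "(\<lambda>x. \<Prod>k\<in>I - {fst e, snd e}. indicator {0<..} (cross_diff (x (fst e)) (x (snd e)) (x k)) :: ennreal) \<in> borel_measurable (sample I)"
    proof (rule borel_measurable_prod_ennreal)
      fix k assume "k \<in> I - {fst e, snd e}"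
      then have [measurable]: "k \<in> I" by auto
      show "(\<lambda>x. indicator {0<..} (cross_diff (x (fst e)) (x (snd e)) (x k)) :: ennreal) \<in> borel_measurable (sample I)"
        by measurable
    qed
  qed
  also have "\<dots> = (\<Sum>e\<in>P. pair_moment (card I - 2) / ennreal (area ^ card I))"
    using fin by (intro sum.cong refl nn_integral_ccw_edge) (auto simp: P_def)
  also have "\<dots> = of_nat (card I * (card I - 1)) * (pair_moment (card I - 2) / ennreal (area ^ card I))"
    by (simp add: cardP)
  finally show ?thesis .
qed

text \<open>The expected cardinality of \<open>ccw_edges\<close>. It gives the expected vertices
  from \<open>n = 2\<close> on and the expected edges from \<open>n = 3\<close> on; at
  \<open>n = 1\<close> it is 0 although a point has a vertex, and at \<open>n = 2\<close> it is 2
  although a segment has one edge.\<close>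

definition mean_edges :: "nat \<Rightarrow> real"
  where "mean_edges n = real (n * (n - 1)) * enn2real (pair_moment (n - 2)) / area ^ n"

lemma ennreal_mean_edges:
  "ennreal (mean_edges n) = of_nat (n * (n - 1)) * (pair_moment (n - 2) / ennreal (area ^ n))"
proof -
  obtain r where r: "0 \<le> r" "pair_moment (n - 2) = ennreal r"
    using pair_moment_finite[of "n - 2"] by (cases "pair_moment (n - 2)") auto
  have "of_nat (n * (n - 1)) * (pair_moment (n - 2) / ennreal (area ^ n)) = ennreal (real (n * (n - 1))) * ennreal (r / area ^ n)"
    using area_pos r by (simp only: r divide_ennreal zero_less_power ennreal_of_nat_eq_real_of_nat)
  also have "\<dots> = ennreal (real (n * (n - 1)) * (r / area ^ n))"
    using area_pos r by (intro ennreal_mult[symmetric]) auto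
  also have "real (n * (n - 1)) * (r / area ^ n) = mean_edges n" using r by (simp add: mean_edges_def)
  finally show ?thesis ..
qed

lemma mean_edges_nonneg: "0 \<le> mean_edges n"
  using area_pos by (simp add: mean_edges_def)

lemma mean_edges_less:
  assumes n: "n \<ge> 2" shows "mean_edges n < mean_edges (n + 1)"
proof -
  define r s where "r = enn2real (pair_moment (n - 2))" and "s = enn2real (pair_moment (n - 1))"
  have rs: "pair_moment (n - 2) = ennreal r" "pair_moment (n - 1) = ennreal s"
    using pair_moment_finite unfolding r_def s_def by (simp_all add: less_top)
  have nn: "0 \<le> r" "0 \<le> s" by (simp_all add: r_def s_def)
  have "ennreal (real (n - 1) * area * r) < ennreal (real (n + 1) * s)"
    using pair_moment_less[OF n] area_pos nn unfolding rs by (simp add: ennreal_mult)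
  then have *: "real (n - 1) * area * r < real (n + 1) * s"
    using area_pos nn by (subst (asm) ennreal_less_iff) auto
  \<comment> \<open>Both means are sides of \<open>pair_moment_less\<close> multiplied by
    \<open>n / area ^ (n + 1)\<close>.\<close>
  have "mean_edges n = real n / area ^ (n + 1) * (real (n - 1) * area * r)"
    using area_pos by (simp add: mean_edges_def r_def field_simps)
  also have "\<dots> < real n / area ^ (n + 1) * (real (n + 1) * s)"
    using * n area_pos by (intro mult_strict_left_mono divide_pos_pos) auto
  also have "\<dots> = mean_edges (n + 1)"
    using n by (simp add: mean_edges_def s_def distrib_left)
  finally show ?thesis .
qed

lemma mean_edges_2: "mean_edges 2 = 2"
proof -
  have "pair_moment 0 = ennreal (area * area)"
    using area_pos by (simp add: pair_moment_def nn_integral_cmult nn_integral_multc emeasure_K ennreal_mult)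
  then show ?thesis using area_pos by (simp add: mean_edges_def power2_eq_square)
qed

text \<open>Agreement almost everywhere gives equal nonnegative integrals; \<open>meas\<close> links
  the Bochner integral in \<open>expected_faces\<close> to the nonnegative one.\<close>

lemma expected_faces_eqI:
  assumes meas: "(\<lambda>x. real (num_faces i (convex hull (x ` {..<n})))) \<in> borel_measurable (sample {..<n})"
    and eq: "AE x in sample {..<n}. num_faces i (convex hull (x ` {..<n})) = card (ccw_edges {..<n} x)"
  shows "expected_faces i K n = mean_edges n"
proof -
  have "expected_faces i K n = enn2real (\<integral>\<^sup>+x. ennreal (real (num_faces i (convex hull (x ` {..<n})))) \<partial>sample {..<n})"
    unfolding expected_faces_def using meas by (intro integral_eq_nn_integral) auto
  also have "(\<integral>\<^sup>+x. ennreal (real (num_faces i (convex hull (x ` {..<n})))) \<partial>sample {..<n}) =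
      (\<integral>\<^sup>+x. of_nat (card (ccw_edges {..<n} x)) \<partial>sample {..<n})"
    using eq by (intro nn_integral_cong_AE) (auto elim!: eventually_mono simp: ennreal_of_nat_eq_real_of_nat)
  also have "\<dots> = ennreal (mean_edges n)"
    by (subst nn_integral_card_ccw_edges) (simp_all add: ennreal_mean_edges)
  finally show ?thesis by (simp add: mean_edges_nonneg)
qed

lemma expected_faces_constI:
  assumes meas: "(\<lambda>x. real (num_faces i (convex hull (x ` {..<n})))) \<in> borel_measurable (sample {..<n})"
    and eq: "AE x in sample {..<n}. num_faces i (convex hull (x ` {..<n})) = c"
  shows "expected_faces i K n = real c"
proof -
  interpret prob_space "sample {..<n}" by (rule prob_space_sample)
  have "expected_faces i K n = (\<integral>x. real c \<partial>sample {..<n})"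
    unfolding expected_faces_def using meas eq by (intro integral_cong_AE) (auto elim!: eventually_mono)
  then show ?thesis by (simp add: prob_space)
qed

lemma measurable_num_faces:
  assumes "i \<in> {0, 1}"
  shows "(\<lambda>x. real (num_faces i (convex hull (x ` {..<n})))) \<in> borel_measurable (sample {..<n})"
  using assms measurable_num_faces_0[of "{..<n}" "\<lambda>_. \<mu>"] measurable_num_faces_1[of "{..<n}" "\<lambda>_. \<mu>"] by auto

lemma expected_vertices: "n \<ge> 2 \<Longrightarrow> expected_faces 0 K n = mean_edges n"
  using AE_general_position[of "{..<n}"]
  by (intro expected_faces_eqI measurable_num_faces) (auto elim!: eventually_mono intro: card_ccw_edges_eq_vertices)

lemma expected_edges: "n \<ge> 3 \<Longrightarrow> expected_faces 1 K n = mean_edges n"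
  using AE_general_position[of "{..<n}"]
  by (intro expected_faces_eqI measurable_num_faces) (auto elim!: eventually_mono intro: card_ccw_edges_eq_edges simp del: One_nat_def)

lemma expected_vertices_1: "expected_faces 0 K 1 = 1"
proof -
  have "num_faces 0 (convex hull (x ` {..<1})) = 1" for x :: "nat \<Rightarrow> real^2"
  proof -
    have "{v \<in> {x 0}. v \<notin> convex hull ({x 0} - {v})} = {x 0}" by auto
    then show ?thesis using num_faces_0_convex_hull[of "{x 0}"] by (simp add: lessThan_Suc)
  qed
  then show ?thesis using expected_faces_constI[of 0 1 1] measurable_num_faces by simp
qed

lemma expected_edges_1: "expected_faces 1 K 1 = 0"
proof -
  have "num_faces 1 (convex hull (x ` {..<1})) = 0" for x :: "nat \<Rightarrow> real^2"
  proof -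
    have "2 * num_faces 1 (convex hull {x 0}) = 0"
      by (subst num_faces_1_convex_hull) (auto simp: card_eq_0_iff)
    then show ?thesis by (simp add: lessThan_Suc)
  qed
  then show ?thesis using expected_faces_constI[of 1 1 0] measurable_num_faces by simp
qed

lemma expected_edges_2: "expected_faces 1 K 2 = 1"
proof -
  have "num_faces 1 (convex hull (x ` {..<2})) = 1" if "general_position {..<2} x" for x :: "nat \<Rightarrow> real^2"
  proof -
    have I: "{..<2} = {0, 1::nat}" by auto
    have "ccw_edges {..<2} x = {(0, 1), (1, 0)}" unfolding I ccw_edges_def by auto
    then have "ccw_edges {..<2} x \<union> prod.swap ` ccw_edges {..<2} x = {(0, 1), (1, 0)}" by auto
    then have "2 * num_faces 1 (convex hull (x ` {..<2})) = card {(0::nat, 1::nat), (1, 0)}"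
      using num_faces_1_index_pairs[OF _ that] by (simp only: finite_lessThan)
    also have "\<dots> = 2" by simp
    finally show ?thesis by simp
  qed
  then have "AE x in sample {..<2}. num_faces 1 (convex hull (x ` {..<2})) = 1"
    using AE_general_position[of "{..<2}"] by (auto elim!: eventually_mono simp del: One_nat_def)
  then show ?thesis using expected_faces_constI[of 1 2 1] measurable_num_faces[of 1 2] by simp
qed

lemma expected_faces_less:
  assumes "n \<ge> 1" "i \<in> {0, 1}"
  shows "expected_faces i K n < expected_faces i K (n + 1)"
proof -
  consider "n = 1" | "n = 2" | "n \<ge> 3" using assms(1) by linarith
  then show ?thesis
  proof cases
    case 1
    then show ?thesis
      using assms(2) expected_vertices_1 expected_vertices[of 2] expected_edges_1 expected_edges_2 mean_edges_2
      by (auto simp: numeral_2_eq_2)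
  next
    \<comment> \<open>The expected number of edges is 1 here, below \<open>mean_edges 2 = 2\<close>,
      so the growth of \<open>mean_edges\<close> still gives the claim.\<close>
    case 2
    then show ?thesis
      using assms(2) expected_vertices[of 2] expected_vertices[of 3] expected_edges_2 expected_edges[of 3]
        mean_edges_2 mean_edges_less[of 2] by auto
  next
    case 3
    then show ?thesis
      using assms(2) expected_vertices[of n] expected_vertices[of "n + 1"] expected_edges[of n] expected_edges[of "n + 1"]
        mean_edges_less[of n] by auto
  qed
qed

end

theorem theorem1:
  fixes K :: "(real^2) set" and n i :: nat
  assumes "compact K" and "convex K" and "interior K \<noteq> {}"
    and "n \<ge> 1" and "i \<in> {0, 1}"
  shows "expected_faces i K (n + 1) > expected_faces i K n"
proof -
  interpret planar_convex_body K using assms(1-3) by unfold_locales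
  show ?thesis using assms(4,5) by (rule expected_faces_less)
qed

end
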